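(* Let $L(\lambda)=\lambda E-(J-R)$ be a real $n\times n$ matrix pencil with $E,R\in\mathbb R^{n,n}$ symmetric positive semidefinite and $J\in\mathbb R^{n,n}$ skew-symmetric, $J=-J^\top$. Then the following statements hold. (i) $L(\lambda)$ is singular if and only if $\ker J\cap\ker E\cap\ker R\neq\{0\}$. In that case there exists an orthogonal matrix $U\in\mathbb R^{n,n}$ such that $$U^\top EU=\begin{bmatrix}E_{11}&0\\0&0\end{bmatrix},\quad U^\top JU=\begin{bmatrix}J_{11}&0\\0&0\end{bmatrix},\quad U^\top RU=\begin{bmatrix}R_{11}&0\\0&0\end{bmatrix},$$ where the pencil $\lambda E_{11}-(J_{11}-R_{11})$ is regular and has size $(n-r)\times(n-r)$ with $r=\dim\ker(E-J+R)>0$. In particular, all right and left minimal indices of $L(\lambda)$ in its Kronecker canonical form are zero. (ii) The index of $L(\lambda)$ is at most two. Furthermore, the following statements are equivalent. (a) For any $\varepsilon>0$ there exists a pencil $\lambda\widetilde E-(\widetilde J-\widetilde R)$ with $\widetilde E,\widetilde R\in\mathbb R^{n,n}$ symmetric positive semidefinite and $\widetilde J=-\widetilde J^\top\in\mathbb R^{n,n}$ which is regular and of index two such that $$\big\|[E-\widetilde E,\ J-\widetilde J,\ R-\widetilde R]\big\|_F=\big\|[E-\widetilde E,\ (J-R)-(\widetilde J-\widetilde R)]\big\|_F\leq\varepsilon,$$ i.e., $L(\lambda)$ is in the closure of the set of regular pencils of this structure that have index two. (b) $\ker E\cap\ker R\neq\{0\}$.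
   Context: A square pencil $\lambda E-A$ is regular if $\det(\lambda_0E-A)\neq0$ for some $\lambda_0\in\mathbb C$, and singular otherwise. Every pencil is strictly equivalent to its Kronecker canonical form, a block diagonal pencil with right singular blocks $\mathcal L_{\epsilon}$ of size $\epsilon\times(\epsilon+1)$, left singular blocks $\mathcal L_{\eta}^\top$ of size $(\eta+1)\times\eta$, Jordan blocks for finite eigenvalues, and blocks $\mathcal N_\sigma=\lambda \mathcal J_\sigma(0)-I_\sigma$ for the eigenvalue $\infty$, where $\mathcal J_\sigma(0)$ is the $\sigma\times\sigma$ nilpotent Jordan block. The numbers $\epsilon$ and $\eta$ are the right and left minimal indices. The index of the pencil is the size of the largest block $\mathcal N_\sigma$ (index $0$ if there is no such block, in particular if $E$ is invertible). $\|\cdot\|_F$ is the Frobenius norm.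
   Formalization: The implication from (b) to (a) is claimed only for n ≠ 1: for n = 1 and E = J = R = 0 condition (b) holds, but a 1×1 pencil cannot have index two, so (a) fails; (a) implies (b) is proved for all n. *)

theory Defs
  imports "Jordan_Normal_Form.Matrix_Kernel" "Jordan_Normal_Form.Jordan_Normal_Form_Existence"
begin

text \<open>
  A matrix pencil \<open>\<lambda>E - A\<close> is represented by the pair of its coefficient matrices \<open>E\<close>, \<open>A\<close>
  over the complex numbers; a real pencil is used via its complexification.
\<close>

abbreviation complexify :: "real mat \<Rightarrow> complex mat" where
  "complexify \<equiv> map_mat complex_of_real"

definition regular_pencil :: "complex mat \<Rightarrow> complex mat \<Rightarrow> bool" where
  "regular_pencil E A \<longleftrightarrow> (\<exists>z::complex. det (z \<cdot>\<^sub>m E - A) \<noteq> 0)"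

text \<open>This notion is meant for square pencils only.\<close>

definition singular_pencil :: "complex mat \<Rightarrow> complex mat \<Rightarrow> bool" where
  "singular_pencil E A \<longleftrightarrow> \<not> regular_pencil E A"

definition strictly_equivalent ::
    "complex mat \<Rightarrow> complex mat \<Rightarrow> complex mat \<Rightarrow> complex mat \<Rightarrow> bool" where
  "strictly_equivalent E A E' A' \<longleftrightarrow>
     (\<exists>P\<in>carrier_mat (dim_row E) (dim_row E). \<exists>Q\<in>carrier_mat (dim_col E) (dim_col E).
        invertible_mat P \<and> invertible_mat Q \<and> E' = P * E * Q \<and> A' = P * A * Q)"


text \<open>
  Singular blocks may have index \<open>0\<close>: they are then a zero column (size \<open>0 \<times> 1\<close>) or a zero row
  (size \<open>1 \<times> 0\<close>) of the block diagonal matrix.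
\<close>

datatype kronecker_block =
    Right_Singular nat
  | Left_Singular nat
  | Finite_Jordan nat complex
  | Infinite_Jordan nat

fun block_E :: "kronecker_block \<Rightarrow> complex mat" where
  "block_E (Right_Singular \<epsilon>) = mat \<epsilon> (\<epsilon> + 1) (\<lambda>(i, j). if j = i then 1 else 0)"
| "block_E (Left_Singular \<eta>) = transpose_mat (mat \<eta> (\<eta> + 1) (\<lambda>(i, j). if j = i then 1 else 0))"
| "block_E (Finite_Jordan \<rho> \<mu>) = 1\<^sub>m \<rho>"
| "block_E (Infinite_Jordan \<sigma>) = jordan_block \<sigma> 0"

fun block_A :: "kronecker_block \<Rightarrow> complex mat" where
  "block_A (Right_Singular \<epsilon>) = mat \<epsilon> (\<epsilon> + 1) (\<lambda>(i, j). if j = i + 1 then 1 else 0)"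
| "block_A (Left_Singular \<eta>) = transpose_mat (mat \<eta> (\<eta> + 1) (\<lambda>(i, j). if j = i + 1 then 1 else 0))"
| "block_A (Finite_Jordan \<rho> \<mu>) = jordan_block \<rho> \<mu>"
| "block_A (Infinite_Jordan \<sigma>) = 1\<^sub>m \<sigma>"

fun proper_block :: "kronecker_block \<Rightarrow> bool" where
  "proper_block (Finite_Jordan \<rho> \<mu>) \<longleftrightarrow> 1 \<le> \<rho>"
| "proper_block (Infinite_Jordan \<sigma>) \<longleftrightarrow> 1 \<le> \<sigma>"
| "proper_block _ \<longleftrightarrow> True"

definition kronecker_form :: "complex mat \<Rightarrow> complex mat \<Rightarrow> kronecker_block list \<Rightarrow> bool" where
  "kronecker_form E A K \<longleftrightarrow>
     (\<forall>b\<in>set K. proper_block b) \<and>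
     strictly_equivalent E A (diag_block_mat (map block_E K)) (diag_block_mat (map block_A K))"

definition right_minimal_indices :: "kronecker_block list \<Rightarrow> nat set" where
  "right_minimal_indices K = {\<epsilon>. Right_Singular \<epsilon> \<in> set K}"

definition left_minimal_indices :: "kronecker_block list \<Rightarrow> nat set" where
  "left_minimal_indices K = {\<eta>. Left_Singular \<eta> \<in> set K}"

definition largest_infinite_block :: "kronecker_block list \<Rightarrow> nat" where
  "largest_infinite_block K = Max (insert 0 {\<sigma>. Infinite_Jordan \<sigma> \<in> set K})"

text \<open>
  Well defined, since every pencil has a Kronecker canonical form, which is unique up to the
  order of the blocks.
\<close>

definition pencil_index :: "complex mat \<Rightarrow> complex mat \<Rightarrow> nat" where
  "pencil_index E A = (THE \<nu>. \<exists>K. kronecker_form E A K \<and> \<nu> = largest_infinite_block K)"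


definition psd_mat :: "nat \<Rightarrow> real mat \<Rightarrow> bool" where
  "psd_mat n S \<longleftrightarrow> S \<in> carrier_mat n n \<and> transpose_mat S = S \<and>
     (\<forall>x\<in>carrier_vec n. 0 \<le> x \<bullet> (S *\<^sub>v x))"

definition skew_mat :: "nat \<Rightarrow> real mat \<Rightarrow> bool" where
  "skew_mat n J \<longleftrightarrow> J \<in> carrier_mat n n \<and> J = - transpose_mat J"

text \<open>
  The library's \<open>orthogonal_mat\<close> only asks for pairwise orthogonal nonzero columns; here the
  columns are orthonormal.
\<close>

definition real_orthogonal_mat :: "nat \<Rightarrow> real mat \<Rightarrow> bool" where
  "real_orthogonal_mat n U \<longleftrightarrow> U \<in> carrier_mat n n \<and> transpose_mat U * U = 1\<^sub>m n"

definition append_cols :: "real mat \<Rightarrow> real mat \<Rightarrow> real mat" where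
  "append_cols A B = four_block_mat A B (0\<^sub>m 0 (dim_col A)) (0\<^sub>m 0 (dim_col B))"

definition frobenius_norm :: "real mat \<Rightarrow> real" where
  "frobenius_norm A = sqrt (\<Sum>i<dim_row A. \<Sum>j<dim_col A. (A $$ (i, j))\<^sup>2)"

text \<open>
  The pencil \<open>\<lambda>E - (J - R)\<close> lies in the closure of the set of regular pencils of this structure
  that have index two.
\<close>

definition in_closure_of_index_two :: "nat \<Rightarrow> real mat \<Rightarrow> real mat \<Rightarrow> real mat \<Rightarrow> bool" where
  "in_closure_of_index_two n E J R \<longleftrightarrow>
     (\<forall>\<epsilon>>0. \<exists>E' J' R'.
        psd_mat n E' \<and> psd_mat n R' \<and> skew_mat n J' \<and>
        regular_pencil (complexify E') (complexify (J' - R')) \<and>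
        pencil_index (complexify E') (complexify (J' - R')) = 2 \<and>
        frobenius_norm (append_cols (E - E') (append_cols (J - J') (R - R'))) =
          frobenius_norm (append_cols (E - E') ((J - R) - (J' - R'))) \<and>
        frobenius_norm (append_cols (E - E') ((J - R) - (J' - R'))) \<le> \<epsilon>)"

end

theory Submission
  imports Defs
begin

text \<open>
  Everything about the Kronecker form that is needed can be read off from chains
  \<open>x\<^sub>0, \<dots>, x\<^sub>k\<close> with \<open>E x\<^sub>0 = 0\<close>, \<open>E x\<^sub>i\<^sub>+\<^sub>1 = A x\<^sub>i\<close> and \<open>A x\<^sub>0 \<noteq> 0\<close>. Such chains survive strict
  equivalence and split along block diagonal pencils, so they only have to be found in single
  Kronecker blocks: an infinite block of size \<open>\<sigma>\<close> has one exactly for \<open>k < \<sigma>\<close>, a right singular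
  block of positive index has one for every \<open>k\<close>, and the other blocks have none. Hence a bound on
  the length of chains excludes positive right minimal indices, applied to the transposed pencil it
  excludes positive left minimal indices, and the length of the longest chain then determines the
  index; in particular the index does not depend on the Kronecker form chosen.

  For \<open>A = J - R\<close> a chain \<open>x\<^sub>0, x\<^sub>1, x\<^sub>2\<close> does not exist. Symmetry of \<open>E\<close> and \<open>E x\<^sub>0 = 0\<close> give
  \<open>x\<^sub>0\<^sup>T R x\<^sub>0 = - x\<^sub>0\<^sup>T E x\<^sub>1 = 0\<close>, so \<open>R x\<^sub>0 = 0\<close> and \<open>E x\<^sub>1 = J x\<^sub>0\<close>; then
  \<open>0 = x\<^sub>0\<^sup>T E x\<^sub>2 = x\<^sub>0\<^sup>T J x\<^sub>1 = - x\<^sub>1\<^sup>T J x\<^sub>0 = - x\<^sub>1\<^sup>T E x\<^sub>1\<close>, so \<open>E x\<^sub>1 = 0\<close>, that is \<open>A x\<^sub>0 = 0\<close>.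
  The transposed pencil replaces \<open>J\<close> by \<open>-J\<close> and is of the same kind. A complex chain of a
  real pencil may be replaced by its real or its imaginary part, so real vectors suffice
  (\<open>dissipative_no_long_chain\<close>, \<open>infinity_chain_complexify_iff\<close>).

  Taking the quadratic form of \<open>E - J + R\<close> shows that its kernel is the common kernel of \<open>E\<close>, \<open>J\<close>
  and \<open>R\<close>, on which the whole pencil vanishes; so the pencil is singular if and only if this kernel
  is nontrivial. Reflecting a kernel vector onto the last coordinate splits off a zero row and
  column, and repeating this leaves a regular pencil of the same structure
  (\<open>dissipative_deflation\<close>). Its Kronecker form comes from Jordan forms, and the zero part
  contributes singular blocks of index zero.

  A regular pencil of index two has a chain \<open>x\<^sub>0, x\<^sub>1\<close>, hence a common kernel vector \<open>x\<^sub>0\<close> of \<open>E\<close> and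
  \<open>R\<close>, and \<open>E + R\<close> is singular; singularity passes to limits, and for the limit it says that
  \<open>E\<close> and \<open>R\<close> have a common kernel vector. Conversely, given such a vector \<open>v\<close>, a small multiple
  of the projection onto its orthogonal complement is added to \<open>E\<close>, so that \<open>v\<close> spans the kernel
  of \<open>E\<close>, and if necessary a small skew-symmetric matrix is added to \<open>J\<close>, so that \<open>J v \<noteq> 0\<close>; for
  this last step the size must not be one. The resulting pencil is regular, and as \<open>J v\<close> is orthogonal
  to \<open>v\<close> it lies in the range of \<open>E\<close>, so \<open>v\<close> starts a chain of two vectors
  (\<open>index_two_perturbation\<close>).
\<close>

section \<open>Chains at the eigenvalue infinity\<close>

text \<open>
  The parameter \<open>k\<close> is the last index, so the chain has \<open>k + 1\<close> vectors. Without the condition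
  \<open>A x\<^sub>0 \<noteq> 0\<close> the zero vectors would form chains of every length; with it, an infinite Jordan block of
  size \<open>\<sigma>\<close> has its longest chain at \<open>k = \<sigma> - 1\<close>.
\<close>

definition infinity_chain :: "'a::field mat \<Rightarrow> 'a mat \<Rightarrow> nat \<Rightarrow> bool" where
  "infinity_chain E A k \<longleftrightarrow>
     (\<exists>x. (\<forall>i\<le>k. x i \<in> carrier_vec (dim_col E)) \<and> E *\<^sub>v x 0 = 0\<^sub>v (dim_row E) \<and>
        (\<forall>i<k. E *\<^sub>v x (Suc i) = A *\<^sub>v x i) \<and> A *\<^sub>v x 0 \<noteq> 0\<^sub>v (dim_row A))"

abbreviation direct_sum_mat :: "'a::zero mat \<Rightarrow> 'a mat \<Rightarrow> 'a mat" where
  "direct_sum_mat A B \<equiv> four_block_mat A (0\<^sub>m (dim_row A) (dim_col B)) (0\<^sub>m (dim_row B) (dim_col A)) B"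

lemma direct_sum_mat_mult_vec:
  assumes "A \<in> carrier_mat nr1 nc1" "B \<in> carrier_mat nr2 nc2"
    and "a \<in> carrier_vec nc1" "b \<in> carrier_vec nc2"
  shows "direct_sum_mat A B *\<^sub>v (a @\<^sub>v b) = (A *\<^sub>v a) @\<^sub>v (B *\<^sub>v b)"
  using assms by (subst four_block_mat_mult_vec[where ?nr1.0=nr1 and ?nc1.0=nc1 and ?nr2.0=nr2 and ?nc2.0=nc2]) auto

lemma append_vec_eq_zero_iff:
  assumes "a \<in> carrier_vec n" "b \<in> carrier_vec m"
  shows "a @\<^sub>v b = 0\<^sub>v (n + m) \<longleftrightarrow> a = 0\<^sub>v n \<and> b = 0\<^sub>v m"
proof -
  have zero: "0\<^sub>v (n + m) = 0\<^sub>v n @\<^sub>v 0\<^sub>v m" by (intro eq_vecI) auto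
  show ?thesis unfolding zero by (rule append_vec_eq[OF assms(1)]) simp
qed

lemma mult_mat_vec_zero:
  fixes A :: "'a::semiring_0 mat"
  assumes "A \<in> carrier_mat nr nc"
  shows "A *\<^sub>v 0\<^sub>v nc = 0\<^sub>v nr"
  using assms by (intro eq_vecI) auto

text \<open>
  Both coordinate parts of a chain satisfy the chain equations; the part on which \<open>A x\<^sub>0\<close> does not
  vanish is a chain of that summand. Conversely chains are padded with zeros.
\<close>

lemma infinity_chain_direct_sum:
  assumes E1: "E1 \<in> carrier_mat r1 c1" and A1: "A1 \<in> carrier_mat r1 c1"
    and E2: "E2 \<in> carrier_mat r2 c2" and A2: "A2 \<in> carrier_mat r2 c2"
  shows "infinity_chain (direct_sum_mat E1 E2) (direct_sum_mat A1 A2) k \<longleftrightarrow>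
           infinity_chain E1 A1 k \<or> infinity_chain E2 A2 k"
proof -
  define E where "E = direct_sum_mat E1 E2"
  define A where "A = direct_sum_mat A1 A2"
  note mE = direct_sum_mat_mult_vec[OF E1 E2, folded E_def]
    and mA = direct_sum_mat_mult_vec[OF A1 A2, folded A_def]
  have dims: "dim_row E = r1 + r2" "dim_col E = c1 + c2" "dim_row A = r1 + r2"
    "dim_row E1 = r1" "dim_row E2 = r2" "dim_col E1 = c1" "dim_col E2 = c2"
    "dim_row A1 = r1" "dim_row A2 = r2" using E1 E2 A1 A2 by (auto simp: E_def A_def)
  show ?thesis unfolding E_def[symmetric] A_def[symmetric]
  proof
    assume "infinity_chain E A k"
    then obtain x where x: "\<And>i. i \<le> k \<Longrightarrow> x i \<in> carrier_vec (c1 + c2)"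
      and x0: "E *\<^sub>v x 0 = 0\<^sub>v (r1 + r2)" and xs: "\<And>i. i < k \<Longrightarrow> E *\<^sub>v x (Suc i) = A *\<^sub>v x i"
      and nz: "A *\<^sub>v x 0 \<noteq> 0\<^sub>v (r1 + r2)"
      unfolding infinity_chain_def dims by blast
    define y where "y i = vec_first (x i) c1" for i
    define z where "z i = vec_last (x i) c2" for i
    have y: "y i \<in> carrier_vec c1" and z: "z i \<in> carrier_vec c2" for i
      by (auto simp: y_def z_def)
    have yz: "x i = y i @\<^sub>v z i" if "i \<le> k" for i
      using x[OF that] by (simp add: y_def z_def)
    have 1: "E1 *\<^sub>v y 0 = 0\<^sub>v r1" "E2 *\<^sub>v z 0 = 0\<^sub>v r2"
      using x0 E1 E2 y z
      by (auto simp: yz mE[OF y z] append_vec_eq_zero_iff)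
    have 2: "E1 *\<^sub>v y (Suc i) = A1 *\<^sub>v y i" "E2 *\<^sub>v z (Suc i) = A2 *\<^sub>v z i" if "i < k" for i
    proof -
      have "(E1 *\<^sub>v y (Suc i)) @\<^sub>v (E2 *\<^sub>v z (Suc i)) = (A1 *\<^sub>v y i) @\<^sub>v (A2 *\<^sub>v z i)"
        using xs[OF that] that by (simp add: yz mE[OF y z] mA[OF y z])
      then show "E1 *\<^sub>v y (Suc i) = A1 *\<^sub>v y i" "E2 *\<^sub>v z (Suc i) = A2 *\<^sub>v z i"
        using append_vec_eq[of "E1 *\<^sub>v y (Suc i)" r1 "A1 *\<^sub>v y i"] E1 A1 y by auto
    qed
    have 3: "A1 *\<^sub>v y 0 \<noteq> 0\<^sub>v r1 \<or> A2 *\<^sub>v z 0 \<noteq> 0\<^sub>v r2"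
      using nz A1 A2 y z by (auto simp: yz mA[OF y z] append_vec_eq_zero_iff)
    show "infinity_chain E1 A1 k \<or> infinity_chain E2 A2 k"
      unfolding infinity_chain_def dims using 1 2 3 y z by blast
  next
    assume "infinity_chain E1 A1 k \<or> infinity_chain E2 A2 k"
    then show "infinity_chain E A k"
    proof
      assume "infinity_chain E1 A1 k"
      then obtain x where x: "\<And>i. i \<le> k \<Longrightarrow> x i \<in> carrier_vec c1"
        and x0: "E1 *\<^sub>v x 0 = 0\<^sub>v r1" and xs: "\<And>i. i < k \<Longrightarrow> E1 *\<^sub>v x (Suc i) = A1 *\<^sub>v x i"
        and nz: "A1 *\<^sub>v x 0 \<noteq> 0\<^sub>v r1"
        unfolding infinity_chain_def dims by blast
      show ?thesis unfolding infinity_chain_def dims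
      proof (rule exI[of _ "\<lambda>i. x i @\<^sub>v 0\<^sub>v c2"], intro conjI allI impI)
        show "E *\<^sub>v (x 0 @\<^sub>v 0\<^sub>v c2) = 0\<^sub>v (r1 + r2)"
          using E1 E2 x x0 by (subst mE) (auto simp: append_vec_eq_zero_iff)
        show "A *\<^sub>v (x 0 @\<^sub>v 0\<^sub>v c2) \<noteq> 0\<^sub>v (r1 + r2)"
          using A1 A2 x nz by (subst mA) (auto simp: append_vec_eq_zero_iff)
        show "E *\<^sub>v (x (Suc i) @\<^sub>v 0\<^sub>v c2) = A *\<^sub>v (x i @\<^sub>v 0\<^sub>v c2)" if "i < k" for i
          using E2 A2 x[of i] x[of "Suc i"] that xs[OF that] by (auto simp: mE mA mult_mat_vec_zero)
      qed (use x in auto)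
    next
      assume "infinity_chain E2 A2 k"
      then obtain x where x: "\<And>i. i \<le> k \<Longrightarrow> x i \<in> carrier_vec c2"
        and x0: "E2 *\<^sub>v x 0 = 0\<^sub>v r2" and xs: "\<And>i. i < k \<Longrightarrow> E2 *\<^sub>v x (Suc i) = A2 *\<^sub>v x i"
        and nz: "A2 *\<^sub>v x 0 \<noteq> 0\<^sub>v r2"
        unfolding infinity_chain_def dims by blast
      show ?thesis unfolding infinity_chain_def dims
      proof (rule exI[of _ "\<lambda>i. 0\<^sub>v c1 @\<^sub>v x i"], intro conjI allI impI)
        show "E *\<^sub>v (0\<^sub>v c1 @\<^sub>v x 0) = 0\<^sub>v (r1 + r2)"
          using E1 E2 x x0 by (subst mE) (auto simp: append_vec_eq_zero_iff)
        show "A *\<^sub>v (0\<^sub>v c1 @\<^sub>v x 0) \<noteq> 0\<^sub>v (r1 + r2)"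
          using A1 A2 x nz by (subst mA) (auto simp: append_vec_eq_zero_iff)
        show "E *\<^sub>v (0\<^sub>v c1 @\<^sub>v x (Suc i)) = A *\<^sub>v (0\<^sub>v c1 @\<^sub>v x i)" if "i < k" for i
          using E1 A1 x[of i] x[of "Suc i"] that xs[OF that] by (auto simp: mE mA mult_mat_vec_zero)
      qed (use x in auto)
    qed
  qed
qed

lemma infinity_chain_diag_block_mat:
  assumes "\<And>b. b \<in> set K \<Longrightarrow> dim_row (f b) = dim_row (g b) \<and> dim_col (f b) = dim_col (g b)"
  shows "infinity_chain (diag_block_mat (map f K)) (diag_block_mat (map g K)) k \<longleftrightarrow>
           (\<exists>b\<in>set K. infinity_chain (f b) (g b) k)"
  using assms
proof (induction K)
  case Nil
  show ?case by (auto simp: infinity_chain_def intro!: eq_vecI)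
next
  case (Cons b K)
  let ?F = "diag_block_mat (map f K)" and ?G = "diag_block_mat (map g K)"
  have "map dim_row (map f K) = map dim_row (map g K)" "map dim_col (map f K) = map dim_col (map g K)"
    using Cons.prems by auto
  then have dims: "dim_row ?G = dim_row ?F" "dim_col ?G = dim_col ?F"
    unfolding dim_diag_block_mat by presburger+
  have "infinity_chain (direct_sum_mat (f b) ?F) (direct_sum_mat (g b) ?G) k \<longleftrightarrow>
      infinity_chain (f b) (g b) k \<or> infinity_chain ?F ?G k"
    by (rule infinity_chain_direct_sum[of _ "dim_row (f b)" "dim_col (f b)" _ _ "dim_row ?F" "dim_col ?F"])
       (use Cons.prems[of b] dims in \<open>auto intro!: carrier_matI\<close>)
  moreover have "infinity_chain ?F ?G k \<longleftrightarrow> (\<exists>b\<in>set K. infinity_chain (f b) (g b) k)"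
    using Cons by simp
  ultimately show ?case by (simp add: Let_def)
qed

lemma transpose_diag_block_mat:
  "transpose_mat (diag_block_mat (map f K)) = diag_block_mat (map (\<lambda>b. transpose_mat (f b)) K)"
proof (induction K)
  case (Cons b K)
  let ?F = "diag_block_mat (map f K)"
  have "transpose_mat (direct_sum_mat (f b) ?F) = direct_sum_mat (transpose_mat (f b)) (transpose_mat ?F)"
    by (intro eq_matI) auto
  then show ?case using Cons by (simp add: Let_def)
qed simp

text \<open>
  The first vector of a chain lies in the kernel of \<open>E\<close>.
\<close>

lemma no_infinity_chain_if_injective:
  assumes "dim_row A = dim_row E" "dim_col A = dim_col E"
    and "\<And>x. x \<in> carrier_vec (dim_col E) \<Longrightarrow> E *\<^sub>v x = 0\<^sub>v (dim_row E) \<Longrightarrow> x = 0\<^sub>v (dim_col E)"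
  shows "\<not> infinity_chain E A k"
proof -
  have "A *\<^sub>v 0\<^sub>v (dim_col E) = 0\<^sub>v (dim_row A)" 
    by (rule mult_mat_vec_zero) (use assms in \<open>auto intro!: carrier_matI\<close>)
  with assms show ?thesis unfolding infinity_chain_def by auto
qed


text \<open>
  The chain runs down the unit vectors \<open>e\<^sub>\<epsilon>, \<dots>, e\<^sub>0\<close>. Since \<open>A e\<^sub>0 = 0\<close>, it may be continued by zero
  vectors forever.
\<close>

lemma infinity_chain_Right_Singular:
  assumes "0 < \<epsilon>"
  shows "infinity_chain (block_E (Right_Singular \<epsilon>)) (block_A (Right_Singular \<epsilon>)) k"
proof -
  define x :: "nat \<Rightarrow> complex vec" where
    "x i = vec (\<epsilon> + 1) (\<lambda>j. if j + i = \<epsilon> then 1 else 0)" for i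
  let ?E = "mat \<epsilon> (\<epsilon> + 1) (\<lambda>(i, j). if j = i then 1 else 0) :: complex mat"
  let ?A = "mat \<epsilon> (\<epsilon> + 1) (\<lambda>(i, j). if j = i + 1 then 1 else 0) :: complex mat"
  have E: "?E *\<^sub>v v = vec \<epsilon> (\<lambda>i. v $ i)" if "v \<in> carrier_vec (\<epsilon> + 1)" for v
    using that by (intro eq_vecI) (auto simp: scalar_prod_def if_distrib[of "\<lambda>t. t * _"] cong: if_cong)
  have A: "?A *\<^sub>v v = vec \<epsilon> (\<lambda>i. v $ (i + 1))" if "v \<in> carrier_vec (\<epsilon> + 1)" for v
    using that by (intro eq_vecI) (auto simp: scalar_prod_def if_distrib[of "\<lambda>t. t * _"] cong: if_cong)
  have x: "x i \<in> carrier_vec (\<epsilon> + 1)" for i by (auto simp: x_def)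
  show ?thesis unfolding infinity_chain_def block_E.simps block_A.simps
  proof (rule exI[of _ x], intro conjI allI impI)
    show "?E *\<^sub>v x 0 = 0\<^sub>v (dim_row ?E)" unfolding E[OF x] by (auto simp: x_def)
    show "?E *\<^sub>v x (Suc i) = ?A *\<^sub>v x i" for i unfolding E[OF x] A[OF x] by (auto simp: x_def)
    show "?A *\<^sub>v x 0 \<noteq> 0\<^sub>v (dim_row ?A)"
    proof
      assume "?A *\<^sub>v x 0 = 0\<^sub>v (dim_row ?A)"
      then have "vec \<epsilon> (\<lambda>i. x 0 $ (i + 1)) $ (\<epsilon> - 1) = 0\<^sub>v \<epsilon> $ (\<epsilon> - 1)" unfolding A[OF x] by simp
      then show False using assms by (simp add: x_def)
    qed
  qed (use x in auto)
qed

lemma not_infinity_chain_Right_Singular_0: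
  "\<not> infinity_chain (block_E (Right_Singular 0)) (block_A (Right_Singular 0)) k"
  unfolding infinity_chain_def by auto

lemma not_infinity_chain_Left_Singular:
  "\<not> infinity_chain (block_E (Left_Singular \<eta>)) (block_A (Left_Singular \<eta>)) k"
proof (rule no_infinity_chain_if_injective)
  fix x :: "complex vec"
  let ?E = "block_E (Left_Singular \<eta>)"
  assume "x \<in> carrier_vec (dim_col ?E)" and Ex: "?E *\<^sub>v x = 0\<^sub>v (dim_row ?E)"
  then have x: "x \<in> carrier_vec \<eta>" by simp
  show "x = 0\<^sub>v (dim_col ?E)"
  proof (rule eq_vecI)
    fix i assume "i < dim_vec (0\<^sub>v (dim_col ?E) :: complex vec)"
    then have i: "i < \<eta>" by simp
    have "x $ i = (?E *\<^sub>v x) $ i"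
      using i x by (simp add: scalar_prod_def if_distrib[of "\<lambda>t. t * _"] cong: if_cong)
    also have "\<dots> = 0" unfolding Ex using i by simp
    finally show "x $ i = 0\<^sub>v (dim_col ?E) $ i" using i by simp
  qed (use x in simp)
qed auto

lemma not_infinity_chain_Finite_Jordan:
  "\<not> infinity_chain (block_E (Finite_Jordan \<rho> \<mu>)) (block_A (Finite_Jordan \<rho> \<mu>)) k"
  by (rule no_infinity_chain_if_injective) auto

text \<open>
  In such a block the chain equations say \<open>x\<^sub>i = N x\<^sub>i\<^sub>+\<^sub>1\<close> and \<open>N x\<^sub>0 = 0\<close>, so each \<open>x\<^sub>i\<close> is
  \<open>x\<^sub>i\<^sub>+\<^sub>1\<close> with its coordinates shifted up. If \<open>k \<ge> \<sigma>\<close>, every coordinate of \<open>x\<^sub>0\<close> has been shifted in from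
  below the last row, hence vanishes. The unit vectors form the longest chain.
\<close>

lemma infinity_chain_Infinite_Jordan_iff:
  "infinity_chain (block_E (Infinite_Jordan \<sigma>)) (block_A (Infinite_Jordan \<sigma>)) k \<longleftrightarrow> k < \<sigma>"
proof -
  let ?N = "jordan_block \<sigma> 0 :: complex mat"
  have N: "?N *\<^sub>v v = vec \<sigma> (\<lambda>i. if Suc i < \<sigma> then v $ Suc i else 0)" if v: "v \<in> carrier_vec \<sigma>" for v
  proof (rule eq_vecI)
    fix i assume "i < dim_vec (vec \<sigma> (\<lambda>i. if Suc i < \<sigma> then v $ Suc i else 0))"
    then have i: "i < \<sigma>" by simp
    have "(?N *\<^sub>v v) $ i = (\<Sum>j = 0..<\<sigma>. ?N $$ (i, j) * v $ j)"
      using i v by (simp add: scalar_prod_def)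
    also have "\<dots> = (\<Sum>j = 0..<\<sigma>. if j = Suc i then v $ j else 0)"
      using i by (intro sum.cong) auto
    finally show "(?N *\<^sub>v v) $ i = vec \<sigma> (\<lambda>i. if Suc i < \<sigma> then v $ Suc i else 0) $ i"
      using i by simp
  qed simp
  show ?thesis
  proof
    assume "infinity_chain (block_E (Infinite_Jordan \<sigma>)) (block_A (Infinite_Jordan \<sigma>)) k"
    then obtain x where x: "\<And>i. i \<le> k \<Longrightarrow> x i \<in> carrier_vec \<sigma>"
      and x0: "?N *\<^sub>v x 0 = 0\<^sub>v \<sigma>" and xs: "\<And>i. i < k \<Longrightarrow> ?N *\<^sub>v x (Suc i) = 1\<^sub>m \<sigma> *\<^sub>v x i"
      and nz: "1\<^sub>m \<sigma> *\<^sub>v x 0 \<noteq> 0\<^sub>v \<sigma>" 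
      unfolding infinity_chain_def block_E.simps block_A.simps jordan_block_index index_one_mat by blast
    have step: "x i $ j = (if Suc j < \<sigma> then x (Suc i) $ Suc j else 0)" if "i < k" "j < \<sigma>" for i j
    proof -
      have "x i = ?N *\<^sub>v x (Suc i)" using xs[OF that(1)] x[of i] that by simp
      then show ?thesis using that x[of "Suc i"] by (simp add: N)
    qed
    \<comment> \<open>Coordinate j of x i reaches the last row after \<open>\<sigma> - 1 - j\<close> steps, and
       one further step is available to make it zero.\<close>
    have shift: "x i $ j = 0" if "j < \<sigma>" "i + (\<sigma> - j) \<le> k" for i j
      using that
    proof (induction "\<sigma> - j" arbitrary: i j)
      case (Suc d)
      then have "i < k" by simp
      then show ?case using step[of i j] Suc.hyps(1)[of "Suc j" "Suc i"] Suc.hyps(2) Suc.prems by auto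
    qed auto
    show "k < \<sigma>"
    proof (rule ccontr)
      assume "\<not> k < \<sigma>"
      then have "x 0 = 0\<^sub>v \<sigma>" using x[of 0] by (intro eq_vecI) (auto intro!: shift)
      with nz show False by simp
    qed
  next
    assume k: "k < \<sigma>"
    define x :: "nat \<Rightarrow> complex vec" where "x i = unit_vec \<sigma> i" for i
    have x: "x i \<in> carrier_vec \<sigma>" for i by (simp add: x_def)
    show "infinity_chain (block_E (Infinite_Jordan \<sigma>)) (block_A (Infinite_Jordan \<sigma>)) k"
      unfolding infinity_chain_def block_E.simps block_A.simps
    proof (rule exI[of _ x], intro conjI allI impI)
      show "?N *\<^sub>v x 0 = 0\<^sub>v (dim_row ?N)" unfolding N[OF x] by (auto simp: x_def)
      show "?N *\<^sub>v x (Suc i) = 1\<^sub>m \<sigma> *\<^sub>v x i" if "i < k" for i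
        unfolding N[OF x] using k that by (auto simp: x_def intro!: eq_vecI)
      show "1\<^sub>m \<sigma> *\<^sub>v x 0 \<noteq> 0\<^sub>v (dim_row (1\<^sub>m \<sigma>))"
      proof
        assume "1\<^sub>m \<sigma> *\<^sub>v x 0 = 0\<^sub>v (dim_row (1\<^sub>m \<sigma>))"
        then have "x 0 $ 0 = 0\<^sub>v \<sigma> $ 0" by (simp add: x_def)
        then show False using k by (simp add: x_def)
      qed
    qed (use x in auto)
  qed
qed

section \<open>Strict equivalence, and what chains say about a Kronecker form\<close>

lemma invertible_mat_inverse:
  assumes "invertible_mat P" and P: "P \<in> carrier_mat n n"
  obtains P' where "P' \<in> carrier_mat n n" "P * P' = 1\<^sub>m n" "P' * P = 1\<^sub>m n"
proof -
  obtain B where B: "P * B = 1\<^sub>m (dim_row P)" "B * P = 1\<^sub>m (dim_row B)"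
    using assms unfolding invertible_mat_def inverts_mat_def by auto
  have "dim_col (P * B) = n" "dim_col (B * P) = dim_row B" using B P by auto
  then have "B \<in> carrier_mat n n" using P by (intro carrier_matI) auto
  then show thesis using that[of B] B P by auto
qed

lemma invertible_matI:
  assumes "P \<in> carrier_mat n n" "P' \<in> carrier_mat n n" "P * P' = 1\<^sub>m n" "P' * P = 1\<^sub>m n"
  shows "invertible_mat P"
  using assms unfolding invertible_mat_def inverts_mat_def by (auto intro!: exI[of _ P'])

lemma strictly_equivalentI:
  assumes "E \<in> carrier_mat r c"
    and "P \<in> carrier_mat r r" "P' \<in> carrier_mat r r" "P * P' = 1\<^sub>m r" "P' * P = 1\<^sub>m r"
    and "Q \<in> carrier_mat c c" "Q' \<in> carrier_mat c c" "Q * Q' = 1\<^sub>m c" "Q' * Q = 1\<^sub>m c"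
    and "E' = P * E * Q" "A' = P * A * Q"
  shows "strictly_equivalent E A E' A'"
  using assms invertible_matI[of P r P'] invertible_matI[of Q c Q']
  unfolding strictly_equivalent_def by auto

lemma strictly_equivalentE:
  assumes "strictly_equivalent E A E' A'" and "E \<in> carrier_mat r c" "A \<in> carrier_mat r c"
  obtains P P' Q Q' where
    "P \<in> carrier_mat r r" "P' \<in> carrier_mat r r" "P * P' = 1\<^sub>m r" "P' * P = 1\<^sub>m r"
    "Q \<in> carrier_mat c c" "Q' \<in> carrier_mat c c" "Q * Q' = 1\<^sub>m c" "Q' * Q = 1\<^sub>m c"
    "E' = P * E * Q" "A' = P * A * Q" "E' \<in> carrier_mat r c" "A' \<in> carrier_mat r c"
proof -
  obtain P Q where PQ: "P \<in> carrier_mat r r" "Q \<in> carrier_mat c c" "invertible_mat P" "invertible_mat Q"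
    "E' = P * E * Q" "A' = P * A * Q"
    using assms unfolding strictly_equivalent_def by auto
  obtain P' where P': "P' \<in> carrier_mat r r" "P * P' = 1\<^sub>m r" "P' * P = 1\<^sub>m r"
    using invertible_mat_inverse[OF PQ(3,1)] .
  obtain Q' where Q': "Q' \<in> carrier_mat c c" "Q * Q' = 1\<^sub>m c" "Q' * Q = 1\<^sub>m c"
    using invertible_mat_inverse[OF PQ(4,2)] .
  have "E' \<in> carrier_mat r c" "A' \<in> carrier_mat r c" using PQ assms(2,3) by auto
  then show thesis by (rule that[OF PQ(1) P' PQ(2) Q' PQ(5,6)])
qed

lemma mat_sandwich_sandwich:
  fixes X :: "'a::semiring_1 mat"
  assumes X: "X \<in> carrier_mat r c" and P: "P \<in> carrier_mat r r" "P' \<in> carrier_mat r r"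
    and Q: "Q \<in> carrier_mat c c" "Q' \<in> carrier_mat c c"
  shows "P' * (P * X * Q) * Q' = P' * P * X * (Q * Q')"
proof -
  have PX: "P * X \<in> carrier_mat r c" using P X by simp
  have "P' * (P * X * Q) = P' * P * X * Q"
    using assoc_mult_mat[OF P(2) PX Q(1)] assoc_mult_mat[OF P(2,1) X] by simp
  then show ?thesis
    using assoc_mult_mat[of "P' * P * X" r c Q c Q' c] P X Q by simp
qed

lemma mat_sandwich_cancel:
  fixes X :: "'a::semiring_1 mat"
  assumes "X \<in> carrier_mat r c" "P \<in> carrier_mat r r" "P' \<in> carrier_mat r r" "P' * P = 1\<^sub>m r"
    "Q \<in> carrier_mat c c" "Q' \<in> carrier_mat c c" "Q * Q' = 1\<^sub>m c"
  shows "P' * (P * X * Q) * Q' = X"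
  unfolding mat_sandwich_sandwich[OF assms(1-3,5,6)] assms(4,7) using assms by simp

lemma strictly_equivalent_sym:
  assumes "strictly_equivalent E A E' A'" and E: "E \<in> carrier_mat r c" and A: "A \<in> carrier_mat r c"
  shows "strictly_equivalent E' A' E A"
proof -
  obtain P P' Q Q' where *:
    "P \<in> carrier_mat r r" "P' \<in> carrier_mat r r" "P * P' = 1\<^sub>m r" "P' * P = 1\<^sub>m r"
    "Q \<in> carrier_mat c c" "Q' \<in> carrier_mat c c" "Q * Q' = 1\<^sub>m c" "Q' * Q = 1\<^sub>m c"
    "E' = P * E * Q" "A' = P * A * Q" "E' \<in> carrier_mat r c" "A' \<in> carrier_mat r c"
    using strictly_equivalentE[OF assms] .
  show ?thesis
    by (rule strictly_equivalentI[of _ r c P' P Q' Q])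
      (use * mat_sandwich_cancel[OF E, of P P' Q Q'] mat_sandwich_cancel[OF A, of P P' Q Q'] in auto)
qed

lemma mult_inverses:
  fixes P :: "'a::semiring_1 mat"
  assumes "P \<in> carrier_mat r r" "P' \<in> carrier_mat r r" "P * P' = 1\<^sub>m r"
    "R \<in> carrier_mat r r" "R' \<in> carrier_mat r r" "R * R' = 1\<^sub>m r"
  shows "R * P * (P' * R') = 1\<^sub>m r"
proof -
  have "R * P * (P' * R') = R * P * P' * R'"
    by (rule assoc_mult_mat[symmetric, of _ r r _ r _ r]) (use assms in auto)
  also have "R * P * P' = R * (P * P')"
    by (rule assoc_mult_mat[of _ r r _ r _ r]) (use assms in auto)
  finally show ?thesis using assms(3-6) by simp
qed

lemma strictly_equivalent_trans:
  assumes "strictly_equivalent E A E' A'" "strictly_equivalent E' A' E'' A''"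
    and E: "E \<in> carrier_mat r c" and A: "A \<in> carrier_mat r c"
  shows "strictly_equivalent E A E'' A''"
proof -
  obtain P P' Q Q' where 1:
    "P \<in> carrier_mat r r" "P' \<in> carrier_mat r r" "P * P' = 1\<^sub>m r" "P' * P = 1\<^sub>m r"
    "Q \<in> carrier_mat c c" "Q' \<in> carrier_mat c c" "Q * Q' = 1\<^sub>m c" "Q' * Q = 1\<^sub>m c"
    "E' = P * E * Q" "A' = P * A * Q" "E' \<in> carrier_mat r c" "A' \<in> carrier_mat r c"
    using strictly_equivalentE[OF assms(1) E A] .
  obtain R R' S S' where 2:
    "R \<in> carrier_mat r r" "R' \<in> carrier_mat r r" "R * R' = 1\<^sub>m r" "R' * R = 1\<^sub>m r"
    "S \<in> carrier_mat c c" "S' \<in> carrier_mat c c" "S * S' = 1\<^sub>m c" "S' * S = 1\<^sub>m c"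
    "E'' = R * E' * S" "A'' = R * A' * S"
    using strictly_equivalentE[OF assms(2) 1(11,12)] by metis
  show ?thesis
  proof (rule strictly_equivalentI[OF E, of "R * P" "P' * R'" "Q * S" "S' * Q'"])
    show "E'' = R * P * E * (Q * S)" "A'' = R * P * A * (Q * S)"
      unfolding 2(9,10) 1(9,10)
      using mat_sandwich_sandwich[OF E 1(1) 2(1) 1(5) 2(5)] mat_sandwich_sandwich[OF A 1(1) 2(1) 1(5) 2(5)]
      by blast+
  qed (use 1 2 mult_inverses[of P r P' R R'] mult_inverses[of R' r R P' P]
      mult_inverses[of S c S' Q Q'] mult_inverses[of Q' c Q S' S] in auto)
qed

lemma strictly_equivalent_transpose:
  assumes "strictly_equivalent E A E' A'" and E: "E \<in> carrier_mat r c" and A: "A \<in> carrier_mat r c"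
  shows "strictly_equivalent (transpose_mat E) (transpose_mat A) (transpose_mat E') (transpose_mat A')"
proof -
  obtain P P' Q Q' where *:
    "P \<in> carrier_mat r r" "P' \<in> carrier_mat r r" "P * P' = 1\<^sub>m r" "P' * P = 1\<^sub>m r"
    "Q \<in> carrier_mat c c" "Q' \<in> carrier_mat c c" "Q * Q' = 1\<^sub>m c" "Q' * Q = 1\<^sub>m c"
    "E' = P * E * Q" "A' = P * A * Q"
    using strictly_equivalentE[OF assms] by metis
  have T: "transpose_mat (P * X * Q) = transpose_mat Q * transpose_mat X * transpose_mat P"
    if X: "X \<in> carrier_mat r c" for X
    using * X transpose_mult[of "P * X" r c Q c] transpose_mult[of P r r X c]
      assoc_mult_mat[of "transpose_mat Q" c c "transpose_mat X" r "transpose_mat P" r] by simp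
  show ?thesis
  proof (rule strictly_equivalentI[of _ c r "transpose_mat Q" "transpose_mat Q'" "transpose_mat P" "transpose_mat P'"])
    show "transpose_mat Q * transpose_mat Q' = 1\<^sub>m c" using * transpose_mult[of Q' c c Q c] by simp
    show "transpose_mat Q' * transpose_mat Q = 1\<^sub>m c" using * transpose_mult[of Q c c Q' c] by simp
    show "transpose_mat P * transpose_mat P' = 1\<^sub>m r" using * transpose_mult[of P' r r P r] by simp
    show "transpose_mat P' * transpose_mat P = 1\<^sub>m r" using * transpose_mult[of P r r P' r] by simp
  qed (use * E A T in auto)
qed

text \<open>
  If \<open>E' = P E Q\<close> and \<open>A' = P A Q\<close>, then \<open>Q\<close> carries chains of \<open>(E', A')\<close> to chains of \<open>(E, A)\<close>, because \<open>P\<close>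
  can be cancelled.
\<close>

lemma infinity_chain_strictly_equivalent_imp:
  assumes "strictly_equivalent E A E' A'" and E: "E \<in> carrier_mat r c" and A: "A \<in> carrier_mat r c"
    and "infinity_chain E' A' k"
  shows "infinity_chain E A k"
proof -
  obtain P P' Q where
    P: "P \<in> carrier_mat r r" "P' \<in> carrier_mat r r" "P' * P = 1\<^sub>m r" and Q: "Q \<in> carrier_mat c c"
    and eq: "E' = P * E * Q" "A' = P * A * Q" and carr: "E' \<in> carrier_mat r c" "A' \<in> carrier_mat r c"
    using strictly_equivalentE[OF assms(1) E A] by metis
  obtain x where x: "\<And>i. i \<le> k \<Longrightarrow> x i \<in> carrier_vec c"
    and x0: "E' *\<^sub>v x 0 = 0\<^sub>v r" and xs: "\<And>i. i < k \<Longrightarrow> E' *\<^sub>v x (Suc i) = A' *\<^sub>v x i"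
    and nz: "A' *\<^sub>v x 0 \<noteq> 0\<^sub>v r"
    using assms(4) carr unfolding infinity_chain_def by auto
  have apply_sandwich: "(P * X * Q) *\<^sub>v v = P *\<^sub>v (X *\<^sub>v (Q *\<^sub>v v))"
    if "X \<in> carrier_mat r c" "v \<in> carrier_vec c" for X v
    using that P Q assoc_mult_mat_vec[of "P * X" r c Q c v]
      assoc_mult_mat_vec[of P r r X c "Q *\<^sub>v v"] by simp
  have move: "X *\<^sub>v (Q *\<^sub>v v) = P' *\<^sub>v ((P * X * Q) *\<^sub>v v)"
    if "X \<in> carrier_mat r c" "v \<in> carrier_vec c" for X v
  proof -
    have "P' *\<^sub>v ((P * X * Q) *\<^sub>v v) = (P' * P) *\<^sub>v (X *\<^sub>v (Q *\<^sub>v v))"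
      using that P Q apply_sandwich[OF that]
        assoc_mult_mat_vec[of P' r r P r "X *\<^sub>v (Q *\<^sub>v v)"] by simp
    then show ?thesis using that P Q by simp
  qed
  have nz': "A *\<^sub>v (Q *\<^sub>v x 0) \<noteq> 0\<^sub>v r"
  proof
    assume "A *\<^sub>v (Q *\<^sub>v x 0) = 0\<^sub>v r"
    then have "P *\<^sub>v (A *\<^sub>v (Q *\<^sub>v x 0)) = 0\<^sub>v r" using P by (simp add: mult_mat_vec_zero)
    then show False using nz apply_sandwich[OF A x[of 0]] by (simp add: eq)
  qed
  have dims: "dim_row E = r" "dim_col E = c" "dim_row A = r" using E A by auto
  show ?thesis unfolding infinity_chain_def dims
  proof (rule exI[of _ "\<lambda>i. Q *\<^sub>v x i"], intro conjI allI impI)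
    show "E *\<^sub>v (Q *\<^sub>v x 0) = 0\<^sub>v r"
      using move[OF E x[of 0]] x0 P by (simp add: eq mult_mat_vec_zero)
    show "E *\<^sub>v (Q *\<^sub>v x (Suc i)) = A *\<^sub>v (Q *\<^sub>v x i)" if "i < k" for i
      using move[OF E x[of "Suc i"]] move[OF A x[of i]] xs[OF that] that by (simp add: eq)
  qed (use x Q nz' in auto)
qed

lemma infinity_chain_strictly_equivalent:
  assumes "strictly_equivalent E A E' A'" and E: "E \<in> carrier_mat r c" and A: "A \<in> carrier_mat r c"
  shows "infinity_chain E A k \<longleftrightarrow> infinity_chain E' A' k"
proof -
  have "E' \<in> carrier_mat r c" "A' \<in> carrier_mat r c"
    using strictly_equivalentE[OF assms] by metis+
  then show ?thesis
    using infinity_chain_strictly_equivalent_imp[OF assms]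
      infinity_chain_strictly_equivalent_imp[OF strictly_equivalent_sym[OF assms]] by blast
qed

lemma dim_block_A: "dim_row (block_A b) = dim_row (block_E b)" "dim_col (block_A b) = dim_col (block_E b)"
  by (cases b; simp)+

lemma infinity_chain_kronecker_form:
  assumes "kronecker_form E A K" and E: "E \<in> carrier_mat r c" and A: "A \<in> carrier_mat r c"
  shows "infinity_chain E A k \<longleftrightarrow> (\<exists>b\<in>set K. infinity_chain (block_E b) (block_A b) k)"
proof -
  have "strictly_equivalent E A (diag_block_mat (map block_E K)) (diag_block_mat (map block_A K))"
    using assms(1) unfolding kronecker_form_def by blast
  from infinity_chain_strictly_equivalent[OF this E A] show ?thesis
    by (simp add: infinity_chain_diag_block_mat dim_block_A)
qed

text \<open>
  Transposition exchanges left and right singular blocks, so chains of the transposed pencil detect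
  the left minimal indices.
\<close>

lemma infinity_chain_transpose_kronecker_form:
  assumes "kronecker_form E A K" and E: "E \<in> carrier_mat r c" and A: "A \<in> carrier_mat r c"
  shows "infinity_chain (transpose_mat E) (transpose_mat A) k \<longleftrightarrow>
    (\<exists>b\<in>set K. infinity_chain (transpose_mat (block_E b)) (transpose_mat (block_A b)) k)"
proof -
  have "strictly_equivalent E A (diag_block_mat (map block_E K)) (diag_block_mat (map block_A K))"
    using assms(1) unfolding kronecker_form_def by blast
  note se = strictly_equivalent_transpose[OF this E A]
  have "infinity_chain (transpose_mat E) (transpose_mat A) k \<longleftrightarrow>
    infinity_chain (diag_block_mat (map (\<lambda>b. transpose_mat (block_E b)) K))
      (diag_block_mat (map (\<lambda>b. transpose_mat (block_A b)) K)) k"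
    using infinity_chain_strictly_equivalent[OF se, of c r k] E A by (simp add: transpose_diag_block_mat)
  then show ?thesis
    by (simp add: infinity_chain_diag_block_mat dim_block_A)
qed

lemma right_minimal_indices_zero:
  assumes "kronecker_form E A K" "E \<in> carrier_mat r c" "A \<in> carrier_mat r c"
    and "\<not> infinity_chain E A k" and "\<epsilon> \<in> right_minimal_indices K"
  shows "\<epsilon> = 0"
  using assms infinity_chain_kronecker_form[OF assms(1-3), of k] infinity_chain_Right_Singular[of \<epsilon> k]
  unfolding right_minimal_indices_def by blast

lemma left_minimal_indices_zero:
  assumes "kronecker_form E A K" "E \<in> carrier_mat r c" "A \<in> carrier_mat r c"
    and "\<not> infinity_chain (transpose_mat E) (transpose_mat A) k" and "\<eta> \<in> left_minimal_indices K"
  shows "\<eta> = 0"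
proof (rule ccontr)
  assume "\<eta> \<noteq> 0"
  then have "infinity_chain (transpose_mat (block_E (Left_Singular \<eta>))) (transpose_mat (block_A (Left_Singular \<eta>))) k"
    using infinity_chain_Right_Singular[of \<eta> k] by simp
  then show False
    using assms infinity_chain_transpose_kronecker_form[OF assms(1-3), of k]
    unfolding left_minimal_indices_def by blast
qed

lemma less_largest_infinite_block_iff:
  "k < largest_infinite_block K \<longleftrightarrow> (\<exists>\<sigma>. Infinite_Jordan \<sigma> \<in> set K \<and> k < \<sigma>)"
proof -
  have "{\<sigma>. Infinite_Jordan \<sigma> \<in> set K} = Infinite_Jordan -` set K" by auto
  moreover have "inj Infinite_Jordan" by (auto intro: injI)
  ultimately have "finite {\<sigma>. Infinite_Jordan \<sigma> \<in> set K}" by (simp add: finite_vimageI)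
  then show ?thesis unfolding largest_infinite_block_def by (subst Max_gr_iff) auto
qed

text \<open>
  Once some chain length is excluded, the right singular blocks have index zero and have no
  chains, so only the infinite blocks contribute.
\<close>

lemma infinity_chain_iff_less_largest_infinite_block:
  assumes "kronecker_form E A K" "E \<in> carrier_mat r c" "A \<in> carrier_mat r c"
    and "\<not> infinity_chain E A m"
  shows "infinity_chain E A k \<longleftrightarrow> k < largest_infinite_block K"
proof -
  have "infinity_chain (block_E b) (block_A b) k \<longleftrightarrow> (\<exists>\<sigma>. b = Infinite_Jordan \<sigma> \<and> k < \<sigma>)" if b: "b \<in> set K" for b
  proof (cases b)
    case (Right_Singular \<epsilon>)
    then have "\<epsilon> = 0" using b right_minimal_indices_zero[OF assms] by (auto simp: right_minimal_indices_def)
    then show ?thesis using Right_Singular not_infinity_chain_Right_Singular_0 by auto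
  next
    case (Left_Singular \<eta>) then show ?thesis using not_infinity_chain_Left_Singular by auto
  next
    case (Finite_Jordan \<rho> \<mu>) then show ?thesis using not_infinity_chain_Finite_Jordan by auto
  next
    case (Infinite_Jordan \<sigma>) then show ?thesis using infinity_chain_Infinite_Jordan_iff by auto
  qed
  then show ?thesis
    unfolding infinity_chain_kronecker_form[OF assms(1-3)] less_largest_infinite_block_iff by blast
qed

text \<open>
  All Kronecker forms of the pencil have the same largest infinite block, because chains do not refer
  to the form; this makes the definite description in the definition of the index meaningful.
\<close>

lemma infinity_chain_iff_less_pencil_index:
  assumes K: "kronecker_form E A K" and carr: "E \<in> carrier_mat r c" "A \<in> carrier_mat r c"
    and m: "\<not> infinity_chain E A m"
  shows "infinity_chain E A k \<longleftrightarrow> k < pencil_index E A"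
proof -
  have eq: "largest_infinite_block K' = largest_infinite_block K" if K': "kronecker_form E A K'" for K'
  proof (rule ccontr)
    assume "largest_infinite_block K' \<noteq> largest_infinite_block K"
    then consider "largest_infinite_block K' < largest_infinite_block K"
      | "largest_infinite_block K < largest_infinite_block K'" by linarith
    then show False
      using infinity_chain_iff_less_largest_infinite_block[OF K carr m]
        infinity_chain_iff_less_largest_infinite_block[OF K' carr m] by (metis less_irrefl)
  qed
  have "pencil_index E A = largest_infinite_block K"
    unfolding pencil_index_def
  proof (rule the_equality)
    show "\<exists>K'. kronecker_form E A K' \<and> largest_infinite_block K = largest_infinite_block K'" using K by blast
  qed (use eq in auto)
  then show ?thesis using infinity_chain_iff_less_largest_infinite_block[OF K carr m] by simp
qed

section \<open>Existence of the Kronecker form\<close>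

lemma direct_sum_mat_mult:
  assumes "A \<in> carrier_mat r1 c1" "C \<in> carrier_mat c1 d1" "B \<in> carrier_mat r2 c2" "D \<in> carrier_mat c2 d2"
  shows "direct_sum_mat A B * direct_sum_mat C D = direct_sum_mat (A * C) (B * (D :: 'a::semiring_0 mat))"
proof -
  have "direct_sum_mat A B * direct_sum_mat C D =
      four_block_mat (A * C + 0\<^sub>m r1 c2 * 0\<^sub>m c2 d1) (A * 0\<^sub>m c1 d2 + 0\<^sub>m r1 c2 * D)
        (0\<^sub>m r2 c1 * C + B * 0\<^sub>m c2 d1) (0\<^sub>m r2 c1 * 0\<^sub>m c1 d2 + B * D)"
    using assms by (subst mult_four_block_mat[of _ r1 c1 _ c2 _ r2 _ _ d1 _ d2]) auto
  then show ?thesis using assms by auto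
qed

lemma strictly_equivalent_direct_sum:
  assumes 1: "strictly_equivalent E1 A1 E1' A1'" "E1 \<in> carrier_mat r1 c1" "A1 \<in> carrier_mat r1 c1"
    and 2: "strictly_equivalent E2 A2 E2' A2'" "E2 \<in> carrier_mat r2 c2" "A2 \<in> carrier_mat r2 c2"
  shows "strictly_equivalent (direct_sum_mat E1 E2) (direct_sum_mat A1 A2)
    (direct_sum_mat E1' E2') (direct_sum_mat A1' A2')"
proof -
  obtain P1 P1' Q1 Q1' where *:
    "P1 \<in> carrier_mat r1 r1" "P1' \<in> carrier_mat r1 r1" "P1 * P1' = 1\<^sub>m r1" "P1' * P1 = 1\<^sub>m r1"
    "Q1 \<in> carrier_mat c1 c1" "Q1' \<in> carrier_mat c1 c1" "Q1 * Q1' = 1\<^sub>m c1" "Q1' * Q1 = 1\<^sub>m c1"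
    "E1' = P1 * E1 * Q1" "A1' = P1 * A1 * Q1"
    using strictly_equivalentE[OF 1] by metis
  obtain P2 P2' Q2 Q2' where **:
    "P2 \<in> carrier_mat r2 r2" "P2' \<in> carrier_mat r2 r2" "P2 * P2' = 1\<^sub>m r2" "P2' * P2 = 1\<^sub>m r2"
    "Q2 \<in> carrier_mat c2 c2" "Q2' \<in> carrier_mat c2 c2" "Q2 * Q2' = 1\<^sub>m c2" "Q2' * Q2 = 1\<^sub>m c2"
    "E2' = P2 * E2 * Q2" "A2' = P2 * A2 * Q2"
    using strictly_equivalentE[OF 2] by metis
  have sandwich: "direct_sum_mat (P1 * X * Q1) (P2 * Y * Q2) =
      direct_sum_mat P1 P2 * direct_sum_mat X Y * direct_sum_mat Q1 Q2"
    if "X \<in> carrier_mat r1 c1" "Y \<in> carrier_mat r2 c2" for X Y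
  proof -
    have XY: "P1 * X \<in> carrier_mat r1 c1" "P2 * Y \<in> carrier_mat r2 c2" using that * ** by auto
    show ?thesis
      unfolding direct_sum_mat_mult[OF *(1) that(1) **(1) that(2)] direct_sum_mat_mult[OF XY(1) *(5) XY(2) **(5)] ..
  qed
  show ?thesis
  proof (rule strictly_equivalentI)
    show "direct_sum_mat E1 E2 \<in> carrier_mat (r1 + r2) (c1 + c2)" using 1 2 by simp
    show "direct_sum_mat P1 P2 \<in> carrier_mat (r1 + r2) (r1 + r2)"
      "direct_sum_mat P1' P2' \<in> carrier_mat (r1 + r2) (r1 + r2)"
      "direct_sum_mat Q1 Q2 \<in> carrier_mat (c1 + c2) (c1 + c2)"
      "direct_sum_mat Q1' Q2' \<in> carrier_mat (c1 + c2) (c1 + c2)" using * ** by simp_all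
    show "direct_sum_mat P1 P2 * direct_sum_mat P1' P2' = 1\<^sub>m (r1 + r2)"
      unfolding direct_sum_mat_mult[OF *(1,2) **(1,2)] using * ** by simp
    show "direct_sum_mat P1' P2' * direct_sum_mat P1 P2 = 1\<^sub>m (r1 + r2)"
      unfolding direct_sum_mat_mult[OF *(2,1) **(2,1)] using * ** by simp
    show "direct_sum_mat Q1 Q2 * direct_sum_mat Q1' Q2' = 1\<^sub>m (c1 + c2)"
      unfolding direct_sum_mat_mult[OF *(5,6) **(5,6)] using * ** by simp
    show "direct_sum_mat Q1' Q2' * direct_sum_mat Q1 Q2 = 1\<^sub>m (c1 + c2)"
      unfolding direct_sum_mat_mult[OF *(6,5) **(6,5)] using * ** by simp
    show "direct_sum_mat E1' E2' = direct_sum_mat P1 P2 * direct_sum_mat E1 E2 * direct_sum_mat Q1 Q2"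
      unfolding *(9) **(9) using sandwich[OF 1(2) 2(2)] .
    show "direct_sum_mat A1' A2' = direct_sum_mat P1 P2 * direct_sum_mat A1 A2 * direct_sum_mat Q1 Q2"
      unfolding *(10) **(10) using sandwich[OF 1(3) 2(3)] .
  qed
qed

lemma kronecker_form_strictly_equivalent:
  assumes "kronecker_form E' A' K" "strictly_equivalent E A E' A'" "E \<in> carrier_mat r c" "A \<in> carrier_mat r c"
  shows "kronecker_form E A K"
  using assms strictly_equivalent_trans unfolding kronecker_form_def by blast

lemma kronecker_form_exists_strictly_equivalent:
  assumes "strictly_equivalent E A E' A'" "\<exists>K. kronecker_form E' A' K" "E \<in> carrier_mat r c" "A \<in> carrier_mat r c"
  shows "\<exists>K. kronecker_form E A K"
  using assms kronecker_form_strictly_equivalent[OF _ assms(1,3,4)] by blast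

lemma kronecker_form_direct_sum:
  assumes 1: "kronecker_form E1 A1 K1" "E1 \<in> carrier_mat r1 c1" "A1 \<in> carrier_mat r1 c1"
    and 2: "kronecker_form E2 A2 K2" "E2 \<in> carrier_mat r2 c2" "A2 \<in> carrier_mat r2 c2"
  shows "kronecker_form (direct_sum_mat E1 E2) (direct_sum_mat A1 A2) (K1 @ K2)"
  using strictly_equivalent_direct_sum[OF _ 1(2,3) _ 2(2,3)] 1(1) 2(1)
  unfolding kronecker_form_def by (auto simp: diag_block_mat_append Let_def)

lemma strictly_equivalent_refl:
  assumes "E \<in> carrier_mat r c" "A \<in> carrier_mat r c"
  shows "strictly_equivalent E A E A"
  using assms by (intro strictly_equivalentI[of _ r c "1\<^sub>m r" "1\<^sub>m r" "1\<^sub>m c" "1\<^sub>m c"]) auto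

lemma kronecker_form_blocks:
  assumes "\<forall>b\<in>set K. proper_block b"
  shows "kronecker_form (diag_block_mat (map block_E K)) (diag_block_mat (map block_A K)) K"
proof -
  have "map dim_row (map block_A K) = map dim_row (map block_E K)"
    "map dim_col (map block_A K) = map dim_col (map block_E K)" by (simp_all add: dim_block_A)
  then have "dim_row (diag_block_mat (map block_A K)) = dim_row (diag_block_mat (map block_E K))"
    "dim_col (diag_block_mat (map block_A K)) = dim_col (diag_block_mat (map block_E K))"
    unfolding dim_diag_block_mat by presburger+
  then show ?thesis using assms unfolding kronecker_form_def
    by (auto intro!: strictly_equivalent_refl carrier_matI)
qed

text \<open>
  Allows Kronecker forms to be found for each diagonal block separately.
\<close>

lemma kronecker_form_exists_diag_block_mat:
  assumes "\<And>b. b \<in> set bs \<Longrightarrow> f b \<in> carrier_mat (d b) (d b) \<and> g b \<in> carrier_mat (d b) (d b) \<and> (\<exists>K. kronecker_form (f b) (g b) K)"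
  shows "\<exists>K. kronecker_form (diag_block_mat (map f bs)) (diag_block_mat (map g bs)) K"
  using assms
proof (induction bs)
  case Nil
  show ?case using kronecker_form_blocks[of "[]"] by auto
next
  case (Cons b bs)
  let ?F = "diag_block_mat (map f bs)" and ?G = "diag_block_mat (map g bs)"
  have "map dim_row (map g bs) = map dim_row (map f bs)" "map dim_col (map g bs) = map dim_col (map f bs)"
    using Cons.prems by fastforce+
  then have dims: "dim_row ?G = dim_row ?F" "dim_col ?G = dim_col ?F"
    unfolding dim_diag_block_mat by presburger+
  obtain K1 where K1: "kronecker_form (f b) (g b) K1" and fg: "f b \<in> carrier_mat (d b) (d b)" "g b \<in> carrier_mat (d b) (d b)"
    using Cons.prems[of b] by auto
  obtain K2 where K2: "kronecker_form ?F ?G K2" using Cons by auto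
  have "kronecker_form (direct_sum_mat (f b) ?F) (direct_sum_mat (g b) ?G) (K1 @ K2)"
    by (rule kronecker_form_direct_sum[OF K1 fg K2]) (use dims in \<open>auto intro!: carrier_matI\<close>)
  then show ?case by (auto simp: Let_def)
qed

lemma det_nonzero_inverse:
  fixes M :: "'a::field mat"
  assumes "M \<in> carrier_mat n n" "det M \<noteq> 0"
  obtains M' where "M' \<in> carrier_mat n n" "M * M' = 1\<^sub>m n" "M' * M = 1\<^sub>m n"
  using det_non_zero_imp_unit[OF assms, of "()"] that
  unfolding Units_def by (auto simp: ring_mat_def)

lemma complex_jordan_decomposition:
  fixes M :: "complex mat"
  assumes M: "M \<in> carrier_mat n n"
  obtains js P Q where "\<forall>(m, \<mu>)\<in>set js. 1 \<le> m" "P \<in> carrier_mat n n" "Q \<in> carrier_mat n n"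
    "P * Q = 1\<^sub>m n" "Q * P = 1\<^sub>m n" "M = P * jordan_matrix js * Q" "jordan_matrix js \<in> carrier_mat n n"
proof -
  obtain as where "char_poly M = (\<Prod>a\<leftarrow>as. [:- a, 1:])" using char_poly_factorized[OF M] by auto
  then obtain js where js: "jordan_nf M js" using jordan_nf_exists[OF M] by blast
  then obtain P Q where wit: "similar_mat_wit M (jordan_matrix js) P Q"
    unfolding jordan_nf_def similar_mat_def by blast
  have "0 \<notin> fst ` set js" using js unfolding jordan_nf_def by blast
  then have "\<forall>(m, \<mu>)\<in>set js. 1 \<le> m" by (force simp: image_iff Suc_le_eq)
  then show thesis using that similar_mat_witD2[OF M wit] by blast
qed

lemma diag_block_mat_affine_jordan:
  fixes a b :: "'a::comm_ring_1"
  shows "diag_block_mat (map (\<lambda>(m, \<mu>). a \<cdot>\<^sub>m jordan_block m \<mu> + b \<cdot>\<^sub>m 1\<^sub>m m) js) =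
     a \<cdot>\<^sub>m jordan_matrix js + b \<cdot>\<^sub>m 1\<^sub>m (sum_list (map fst js))"
proof (induction js)
  case (Cons j js)
  obtain m \<mu> where j: "j = (m, \<mu>)" by force
  let ?J = "jordan_matrix js" and ?s = "sum_list (map fst js)"
  have "direct_sum_mat (a \<cdot>\<^sub>m jordan_block m \<mu> + b \<cdot>\<^sub>m 1\<^sub>m m) (a \<cdot>\<^sub>m ?J + b \<cdot>\<^sub>m 1\<^sub>m ?s) =
      a \<cdot>\<^sub>m direct_sum_mat (jordan_block m \<mu>) ?J + b \<cdot>\<^sub>m 1\<^sub>m (m + ?s)"
    by (intro eq_matI) auto
  then show ?case using Cons by (simp add: j jordan_matrix_def Let_def)
qed (auto simp: jordan_matrix_def intro!: eq_matI)

lemma sandwich_affine: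
  fixes T :: "'a::field mat"
  assumes "P \<in> carrier_mat n n" "Q \<in> carrier_mat n n" "P * Q = 1\<^sub>m n" "T \<in> carrier_mat n n"
  shows "P * (a \<cdot>\<^sub>m T + b \<cdot>\<^sub>m 1\<^sub>m n) * Q = a \<cdot>\<^sub>m (P * T * Q) + b \<cdot>\<^sub>m 1\<^sub>m n"
proof -
  have "P * (a \<cdot>\<^sub>m T + b \<cdot>\<^sub>m 1\<^sub>m n) = a \<cdot>\<^sub>m (P * T) + b \<cdot>\<^sub>m P"
    using assms by (simp add: mult_add_distrib_mat[of _ n n _ n] mult_smult_distrib[of _ n n _ n])
  also have "\<dots> * Q = a \<cdot>\<^sub>m (P * T) * Q + b \<cdot>\<^sub>m P * Q"
    by (rule add_mult_distrib_mat[of _ n n _ _ n]) (use assms in auto)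
  also have "\<dots> = a \<cdot>\<^sub>m (P * T * Q) + b \<cdot>\<^sub>m (P * Q)"
    using mult_smult_assoc_mat[of "P * T" n n Q n a] mult_smult_assoc_mat[of P n n Q n b] assms by simp
  finally show ?thesis using assms by simp
qed

lemma kronecker_form_exists_identity_left:
  assumes B: "B \<in> carrier_mat n n"
  shows "\<exists>K. kronecker_form (1\<^sub>m n) B K"
proof -
  obtain js P Q where js: "\<forall>(m, \<mu>)\<in>set js. 1 \<le> m" and PQ: "P \<in> carrier_mat n n" "Q \<in> carrier_mat n n"
    "P * Q = 1\<^sub>m n" "Q * P = 1\<^sub>m n" and BJ: "B = P * jordan_matrix js * Q" and J: "jordan_matrix js \<in> carrier_mat n n"
    using complex_jordan_decomposition[OF B] .
  define K where "K = map (\<lambda>(m, \<mu>). Finite_Jordan m \<mu>) js"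
  have A: "diag_block_mat (map block_A K) = jordan_matrix js"
    unfolding K_def jordan_matrix_def map_map by (intro arg_cong[of _ _ diag_block_mat] map_cong) auto
  have blocks: "map block_E K = map (\<lambda>M. 1\<^sub>m (dim_row M)) (map block_A K)" unfolding K_def by auto
  have E: "diag_block_mat (map block_E K) = 1\<^sub>m n"
    unfolding blocks diag_block_one_mat dim_diag_block_mat(1)[symmetric] A carrier_matD(1)[OF J] ..
  have "\<forall>b\<in>set K. proper_block b" using js by (auto simp: K_def)
  then have "kronecker_form (1\<^sub>m n) (jordan_matrix js) K"
    using kronecker_form_blocks[of K] unfolding A E by blast
  moreover have "strictly_equivalent (1\<^sub>m n) B (1\<^sub>m n) (jordan_matrix js)"
  proof (rule strictly_equivalentI[of _ n n Q P P Q])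
    show "jordan_matrix js = Q * B * P"
      unfolding BJ by (rule mat_sandwich_cancel[OF J PQ(1,2,4,2,1,4), symmetric])
  qed (use PQ in auto)
  ultimately show ?thesis by (intro kronecker_form_exists_strictly_equivalent[of "1\<^sub>m n" B _ _ n n]) (use B in auto)
qed

lemma kronecker_form_exists_if_E_invertible:
  assumes E: "E \<in> carrier_mat n n" and A: "A \<in> carrier_mat n n" and det: "det E \<noteq> 0"
  shows "\<exists>K. kronecker_form E A K"
proof -
  obtain E' where E': "E' \<in> carrier_mat n n" "E * E' = 1\<^sub>m n" "E' * E = 1\<^sub>m n"
    using det_nonzero_inverse[OF E det] .
  have "strictly_equivalent E A (1\<^sub>m n) (E' * A)"
    by (rule strictly_equivalentI[of _ n n E' E "1\<^sub>m n" "1\<^sub>m n"]) (use E' E A in auto)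
  moreover have "E' * A \<in> carrier_mat n n" using E' A by simp
  ultimately show ?thesis
    using kronecker_form_exists_strictly_equivalent kronecker_form_exists_identity_left E A by metis
qed

lemma det_affine_jordan_block:
  fixes a b \<mu> :: "'a::idom"
  shows "det (a \<cdot>\<^sub>m jordan_block m \<mu> + b \<cdot>\<^sub>m 1\<^sub>m m) = (a * \<mu> + b) ^ m"
proof -
  let ?M = "a \<cdot>\<^sub>m jordan_block m \<mu> + b \<cdot>\<^sub>m 1\<^sub>m m"
  have "upper_triangular ?M" by (intro upper_triangularI) auto
  then have "det ?M = prod_list (diag_mat ?M)" by (rule det_upper_triangular[of _ m]) auto
  also have "diag_mat ?M = replicate m (a * \<mu> + b)"
    by (intro nth_equalityI) (auto simp: diag_mat_def)
  finally show ?thesis by (simp add: prod_list_replicate)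
qed

text \<open>
  Bringing \<open>E\<close> to Jordan form reduces the claim to single Jordan blocks. A block with nonzero
  eigenvalue is invertible and may be multiplied to the identity, which leaves a Jordan form of the second
  matrix to be found; the nilpotent blocks are the hypothesis.
\<close>

lemma kronecker_form_exists_affine:
  assumes E: "E \<in> carrier_mat n n"
    and nilpotent: "\<And>m. 1 \<le> m \<Longrightarrow> \<exists>K. kronecker_form (jordan_block m 0) (a \<cdot>\<^sub>m jordan_block m 0 + b \<cdot>\<^sub>m 1\<^sub>m m) K"
  shows "\<exists>K. kronecker_form E (a \<cdot>\<^sub>m E + b \<cdot>\<^sub>m 1\<^sub>m n) K"
proof -
  obtain js P Q where js: "\<forall>(m, \<mu>)\<in>set js. 1 \<le> m" and PQ: "P \<in> carrier_mat n n" "Q \<in> carrier_mat n n"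
    "P * Q = 1\<^sub>m n" "Q * P = 1\<^sub>m n" and EJ: "E = P * jordan_matrix js * Q" and J: "jordan_matrix js \<in> carrier_mat n n"
    using complex_jordan_decomposition[OF E] .
  let ?A = "a \<cdot>\<^sub>m E + b \<cdot>\<^sub>m 1\<^sub>m n" and ?AJ = "a \<cdot>\<^sub>m jordan_matrix js + b \<cdot>\<^sub>m 1\<^sub>m n"
  have "\<exists>K. kronecker_form (diag_block_mat (map (\<lambda>(m, \<mu>). jordan_block m \<mu>) js))
      (diag_block_mat (map (\<lambda>(m, \<mu>). a \<cdot>\<^sub>m jordan_block m \<mu> + b \<cdot>\<^sub>m 1\<^sub>m m) js)) K"
  proof (rule kronecker_form_exists_diag_block_mat[where d = fst], clarify)
    fix m and \<mu> :: complex assume "(m, \<mu>) \<in> set js"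
    then have m: "1 \<le> m" using js by auto
    have "\<exists>K. kronecker_form (jordan_block m \<mu>) (a \<cdot>\<^sub>m jordan_block m \<mu> + b \<cdot>\<^sub>m 1\<^sub>m m) K"
    proof (cases "\<mu> = 0")
      case False
      have "1 \<cdot>\<^sub>m jordan_block m \<mu> + 0 \<cdot>\<^sub>m 1\<^sub>m m = jordan_block m \<mu>" by (intro eq_matI) auto
      then have "det (jordan_block m \<mu>) = \<mu> ^ m" using det_affine_jordan_block[of 1 m \<mu> 0] by simp
      then show ?thesis using False by (intro kronecker_form_exists_if_E_invertible) auto
    qed (use nilpotent m in blast)
    then show "jordan_block m \<mu> \<in> carrier_mat (fst (m, \<mu>)) (fst (m, \<mu>)) \<and>
      a \<cdot>\<^sub>m jordan_block m \<mu> + b \<cdot>\<^sub>m 1\<^sub>m m \<in> carrier_mat (fst (m, \<mu>)) (fst (m, \<mu>)) \<and>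
      (\<exists>K. kronecker_form (jordan_block m \<mu>) (a \<cdot>\<^sub>m jordan_block m \<mu> + b \<cdot>\<^sub>m 1\<^sub>m m) K)" by simp
  qed
  moreover have "sum_list (map fst js) = n" using J by (metis carrier_matD(1) jordan_matrix_dim(1))
  ultimately have "\<exists>K. kronecker_form (jordan_matrix js) ?AJ K"
    by (simp add: diag_block_mat_affine_jordan flip: jordan_matrix_def)
  moreover have "strictly_equivalent E ?A (jordan_matrix js) ?AJ"
  proof (rule strictly_equivalentI[of _ n n Q P P Q])
    have "P * ?AJ * Q = ?A" unfolding EJ by (rule sandwich_affine) (use PQ J in auto)
    then show "?AJ = Q * ?A * P"
      using mat_sandwich_cancel[of ?AJ n n, OF _ PQ(1,2,4,2,1,4)] J by (metis add_carrier_mat one_carrier_mat smult_carrier_mat)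
    show "jordan_matrix js = Q * E * P"
      unfolding EJ by (rule mat_sandwich_cancel[OF J PQ(1,2,4,2,1,4), symmetric])
  qed (use PQ E in auto)
  moreover have "?A \<in> carrier_mat n n" using E by simp
  ultimately show ?thesis by (intro kronecker_form_exists_strictly_equivalent[OF _ _ E])
qed

text \<open>
  The pencil becomes \<open>(A\<inverse>E, I)\<close>, the affine case with \<open>a = 0\<close> and \<open>b = 1\<close>, in which a nilpotent
  Jordan block already is an infinite Kronecker block.
\<close>

lemma kronecker_form_exists_if_A_invertible:
  assumes E: "E \<in> carrier_mat n n" and A: "A \<in> carrier_mat n n" and det: "det A \<noteq> 0"
  shows "\<exists>K. kronecker_form E A K"
proof -
  obtain A' where A': "A' \<in> carrier_mat n n" "A * A' = 1\<^sub>m n" "A' * A = 1\<^sub>m n"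
    using det_nonzero_inverse[OF A det] .
  have carr: "A' * E \<in> carrier_mat n n" using A' E by simp
  have affine: "0 \<cdot>\<^sub>m X + 1 \<cdot>\<^sub>m 1\<^sub>m m = 1\<^sub>m m" if "X \<in> carrier_mat m m" for X :: "complex mat" and m
    by (intro eq_matI) (use that in auto)
  have "\<exists>K. kronecker_form (A' * E) (0 \<cdot>\<^sub>m (A' * E) + 1 \<cdot>\<^sub>m 1\<^sub>m n) K"
  proof (rule kronecker_form_exists_affine[OF carr])
    fix m :: nat assume "1 \<le> m"
    then have "kronecker_form (jordan_block m 0) (1\<^sub>m m) [Infinite_Jordan m]"
      using kronecker_form_blocks[of "[Infinite_Jordan m]"]
      by (simp del: diag_block_mat.simps add: diag_block_mat_singleton)
    then show "\<exists>K. kronecker_form (jordan_block m 0) (0 \<cdot>\<^sub>m jordan_block m 0 + 1 \<cdot>\<^sub>m 1\<^sub>m m) K"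
      using affine[OF jordan_block_carrier] by auto
  qed
  then have "\<exists>K. kronecker_form (A' * E) (1\<^sub>m n) K" using affine[OF carr] by simp
  moreover have "strictly_equivalent E A (A' * E) (1\<^sub>m n)"
    by (rule strictly_equivalentI[of _ n n A' A "1\<^sub>m n" "1\<^sub>m n"]) (use A' E A in auto)
  ultimately show ?thesis by (intro kronecker_form_exists_strictly_equivalent[OF _ _ E A])
qed

text \<open>
  For \<open>M = zE - A\<close> invertible, the pencil is equivalent to \<open>(M\<inverse>E, z M\<inverse>E - I)\<close>. At a nilpotent
  block the second matrix is invertible, which is the case treated before.
\<close>

lemma kronecker_form_exists_if_regular:
  assumes E: "E \<in> carrier_mat n n" and A: "A \<in> carrier_mat n n" and reg: "regular_pencil E A"
  shows "\<exists>K. kronecker_form E A K"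
proof -
  obtain z where z: "det (z \<cdot>\<^sub>m E - A) \<noteq> 0" using reg unfolding regular_pencil_def by blast
  let ?M = "z \<cdot>\<^sub>m E - A"
  have M: "?M \<in> carrier_mat n n" using A by (simp add: minus_carrier_mat)
  obtain M' where M': "M' \<in> carrier_mat n n" "?M * M' = 1\<^sub>m n" "M' * ?M = 1\<^sub>m n"
    using det_nonzero_inverse[OF M z] .
  have carr: "M' * E \<in> carrier_mat n n" using M' E by simp
  have "M' * ?M = z \<cdot>\<^sub>m (M' * E) - M' * A"
    using mult_minus_distrib_mat[of M' n n "z \<cdot>\<^sub>m E" n A] mult_smult_distrib[of M' n n E n z] M' E A by simp
  then have id: "z \<cdot>\<^sub>m (M' * E) - M' * A = 1\<^sub>m n" using M'(3) by simp
  have MA: "M' * A = z \<cdot>\<^sub>m (M' * E) + (-1) \<cdot>\<^sub>m 1\<^sub>m n"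
    unfolding id[symmetric] by (intro eq_matI) (use M'(1) E A in auto)
  have "\<exists>K. kronecker_form (M' * E) (z \<cdot>\<^sub>m (M' * E) + (-1) \<cdot>\<^sub>m 1\<^sub>m n) K"
  proof (rule kronecker_form_exists_affine[OF carr])
    fix m :: nat
    show "\<exists>K. kronecker_form (jordan_block m 0) (z \<cdot>\<^sub>m jordan_block m 0 + (-1) \<cdot>\<^sub>m 1\<^sub>m m) K"
      by (rule kronecker_form_exists_if_A_invertible[of _ m]) (auto simp: det_affine_jordan_block)
  qed
  moreover have "strictly_equivalent E A (M' * E) (z \<cdot>\<^sub>m (M' * E) + (-1) \<cdot>\<^sub>m 1\<^sub>m n)"
    by (rule strictly_equivalentI[of _ n n M' ?M "1\<^sub>m n" "1\<^sub>m n"]) (use M M' E A in \<open>auto simp flip: MA\<close>)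
  ultimately show ?thesis by (intro kronecker_form_exists_strictly_equivalent[OF _ _ E A])
qed

text \<open>
  One zero row and column is the direct sum of the blocks \<open>0 \<times> 1\<close> and \<open>1 \<times> 0\<close>.
\<close>

lemma kronecker_form_zero:
  "\<exists>K. kronecker_form (0\<^sub>m r r) (0\<^sub>m r r) K"
proof (induction r)
  case 0
  show ?case using kronecker_form_blocks[of "[]"] by auto
next
  case (Suc r)
  then obtain K where K: "kronecker_form (0\<^sub>m r r) (0\<^sub>m r r) K" by blast
  have "diag_block_mat (map block_E [Right_Singular 0, Left_Singular 0]) = 0\<^sub>m 1 1"
    "diag_block_mat (map block_A [Right_Singular 0, Left_Singular 0]) = 0\<^sub>m 1 1"
    by (auto simp: Let_def intro!: eq_matI)
  then have "kronecker_form (0\<^sub>m 1 1) (0\<^sub>m 1 1) [Right_Singular 0, Left_Singular 0]"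
    using kronecker_form_blocks[of "[Right_Singular 0, Left_Singular 0]"] by simp
  from kronecker_form_direct_sum[OF this _ _ K, of 1 1 r r] show ?case by auto
qed

section \<open>Dissipative pencils have short chains\<close>

definition dissipative_triple :: "nat \<Rightarrow> real mat \<Rightarrow> real mat \<Rightarrow> real mat \<Rightarrow> bool" where
  "dissipative_triple n E J R \<longleftrightarrow> psd_mat n E \<and> skew_mat n J \<and> psd_mat n R"

lemma real_scalar_prod_self_ge_0: "0 \<le> x \<bullet> (x :: real vec)"
  unfolding scalar_prod_def by (intro sum_nonneg) simp

lemma real_scalar_prod_self_eq_0:
  assumes "x \<bullet> (x :: real vec) = 0" "x \<in> carrier_vec n"
  shows "x = 0\<^sub>v n"
proof (rule eq_vecI)
  fix i assume "i < dim_vec (0\<^sub>v n :: real vec)"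
  moreover have "\<forall>i\<in>{0..<dim_vec x}. x $ i * x $ i = 0"
    using assms(1) unfolding scalar_prod_def by (subst (asm) sum_nonneg_eq_0_iff) auto
  ultimately show "x $ i = 0\<^sub>v n $ i" using assms(2) by auto
qed (use assms in simp)

lemma symmetric_scalar_prod:
  fixes S :: "'a::comm_semiring_0 mat"
  assumes "S \<in> carrier_mat n n" "transpose_mat S = S" "x \<in> carrier_vec n" "y \<in> carrier_vec n"
  shows "x \<bullet> (S *\<^sub>v y) = y \<bullet> (S *\<^sub>v x)"
proof -
  have "x \<bullet> (S *\<^sub>v y) = (S *\<^sub>v x) \<bullet> y"
    using transpose_vec_mult_scalar[OF assms(1,4,3)] assms(2) by simp
  then show ?thesis using assms comm_scalar_prod[of "S *\<^sub>v x" n y] by simp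
qed

lemma skew_scalar_prod:
  assumes J: "skew_mat n J" and "x \<in> carrier_vec n" "y \<in> carrier_vec n"
  shows "x \<bullet> (J *\<^sub>v y) = - (y \<bullet> (J *\<^sub>v x))"
proof -
  have carr: "J \<in> carrier_mat n n" and "J = - transpose_mat J" using J unfolding skew_mat_def by auto
  then have "transpose_mat J = - J" by (metis uminus_uminus_mat)
  then have "x \<bullet> (J *\<^sub>v y) = (- J *\<^sub>v x) \<bullet> y"
    using transpose_vec_mult_scalar[OF carr assms(3,2)] by simp
  also have "\<dots> = - ((J *\<^sub>v x) \<bullet> y)" using carr assms by simp
  finally show ?thesis using carr assms comm_scalar_prod[of "J *\<^sub>v x" n y] by simp
qed

lemma skew_scalar_prod_self:
  assumes "skew_mat n J" "x \<in> carrier_vec n"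
  shows "x \<bullet> (J *\<^sub>v x) = 0"
  using skew_scalar_prod[OF assms assms(2)] by simp

text \<open>
  With \<open>y = S x\<close>, the quadratic form at \<open>x + t y\<close> is \<open>2 t (y \<bullet> y) + t\<^sup>2 (y \<bullet> S y)\<close>. For small negative \<open>t\<close> this
  is negative unless \<open>y = 0\<close>.
\<close>

lemma psd_scalar_prod_eq_0:
  assumes S: "psd_mat n S" and x: "x \<in> carrier_vec n" and zero: "x \<bullet> (S *\<^sub>v x) = 0"
  shows "S *\<^sub>v x = 0\<^sub>v n"
proof -
  have carr: "S \<in> carrier_mat n n" and sym: "transpose_mat S = S"
    and nonneg: "\<And>x. x \<in> carrier_vec n \<Longrightarrow> 0 \<le> x \<bullet> (S *\<^sub>v x)" using S unfolding psd_mat_def by auto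
  define y where "y = S *\<^sub>v x"
  have y: "y \<in> carrier_vec n" using carr x by (simp add: y_def)
  define a where "a = y \<bullet> y"
  define c where "c = y \<bullet> (S *\<^sub>v y)"
  have quad: "0 \<le> 2 * t * a + t\<^sup>2 * c" for t
  proof -
    have "S *\<^sub>v (x + t \<cdot>\<^sub>v y) = y + t \<cdot>\<^sub>v (S *\<^sub>v y)"
      using carr x y by (simp add: mult_add_distrib_mat_vec[OF carr] mult_mat_vec[OF carr] y_def)
    then have "(x + t \<cdot>\<^sub>v y) \<bullet> (S *\<^sub>v (x + t \<cdot>\<^sub>v y)) = x \<bullet> y + t * (x \<bullet> (S *\<^sub>v y)) + t * (y \<bullet> y + t * (y \<bullet> (S *\<^sub>v y)))"
      using carr x y by (simp add: add_scalar_prod_distrib[of _ n] scalar_prod_add_distrib[of _ n] algebra_simps)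
    also have "x \<bullet> (S *\<^sub>v y) = a" using symmetric_scalar_prod[OF carr sym x y] by (simp add: a_def y_def)
    also have "x \<bullet> y = 0" using zero by (simp add: y_def)
    finally show ?thesis using nonneg[of "x + t \<cdot>\<^sub>v y"] x y
      by (simp add: a_def c_def power2_eq_square algebra_simps)
  qed
  have c: "0 \<le> c" unfolding c_def by (rule nonneg[OF y])
  have "a = 0"
  proof (rule ccontr)
    assume "a \<noteq> 0"
    then have a: "0 < a" using real_scalar_prod_self_ge_0[of y] by (simp add: a_def)
    \<comment> \<open>Any t with \<open>- 2 a < t c\<close> and \<open>t < 0\<close> works; adding 1 avoids
       dividing by zero for \<open>c = 0\<close>.\<close>
    define t where "t = - a / (c + 1)"
    have t: "t * (c + 1) = - a" using c by (simp add: t_def)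
    have "(2 * t * a + t\<^sup>2 * c) * (c + 1)\<^sup>2 = 2 * a * (t * (c + 1)) * (c + 1) + c * (t * (c + 1))\<^sup>2"
      by (simp add: power2_eq_square algebra_simps)
    also have "\<dots> = - (a\<^sup>2 * (c + 2))" unfolding t by (simp add: power2_eq_square algebra_simps)
    also have "\<dots> < 0" using a c by simp
    finally have "(2 * t * a + t\<^sup>2 * c) * (c + 1)\<^sup>2 < 0" .
    then show False using quad[of t] by (meson mult_nonneg_nonneg not_le zero_le_power2)
  qed
  then show ?thesis using real_scalar_prod_self_eq_0[OF _ y] by (simp add: a_def y_def)
qed

context
  fixes n :: nat and E J R :: "real mat"
  assumes triple: "dissipative_triple n E J R"
begin

lemma dissipative_carriers:
  shows "E \<in> carrier_mat n n" "J \<in> carrier_mat n n" "R \<in> carrier_mat n n" "J - R \<in> carrier_mat n n"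
    "E - J + R \<in> carrier_mat n n"
  using triple unfolding dissipative_triple_def psd_mat_def skew_mat_def by auto

lemma dissipative_transpose:
  shows "transpose_mat E = E" "transpose_mat (J - R) = - J - R" "dissipative_triple n E (- J) R"
proof -
  have sym: "transpose_mat E = E" "transpose_mat R = R" "J = - transpose_mat J"
    using triple unfolding dissipative_triple_def psd_mat_def skew_mat_def by auto
  then have T: "transpose_mat J = - J" by (metis uminus_uminus_mat)
  show "transpose_mat E = E" by (rule sym)
  show "transpose_mat (J - R) = - J - R"
    using transpose_minus[of J n n R] dissipative_carriers sym T by simp
  show "dissipative_triple n E (- J) R"
    using triple T unfolding dissipative_triple_def skew_mat_def by (simp add: transpose_uminus)
qed

lemma dissipative_apply:
  assumes "x \<in> carrier_vec n"
  shows "(J - R) *\<^sub>v x = J *\<^sub>v x - R *\<^sub>v x" "(E - J + R) *\<^sub>v x = E *\<^sub>v x - J *\<^sub>v x + R *\<^sub>v x"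
  using dissipative_carriers assms minus_carrier_mat[OF dissipative_carriers(2), of E]
  by (simp_all add: minus_mult_distrib_mat_vec[of _ n n] add_mult_distrib_mat_vec[of _ n n])

lemma dissipative_scalar_prod_self:
  assumes x: "x \<in> carrier_vec n"
  shows "x \<bullet> ((J - R) *\<^sub>v x) = - (x \<bullet> (R *\<^sub>v x))"
    "x \<bullet> ((E - J + R) *\<^sub>v x) = x \<bullet> (E *\<^sub>v x) + x \<bullet> (R *\<^sub>v x)"
  using x skew_scalar_prod_self[OF _ x, of J] dissipative_carriers triple
  by (simp_all add: dissipative_apply dissipative_triple_def scalar_prod_minus_distrib[of _ n]
      scalar_prod_add_distrib[of _ n])

text \<open>
  The skew part does not contribute to the quadratic form, so \<open>x\<^sup>T E x + x\<^sup>T R x = 0\<close> on the kernel, and both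
  summands vanish.
\<close>

lemma dissipative_kernel_iff:
  assumes x: "x \<in> carrier_vec n"
  shows "(E - J + R) *\<^sub>v x = 0\<^sub>v n \<longleftrightarrow> E *\<^sub>v x = 0\<^sub>v n \<and> J *\<^sub>v x = 0\<^sub>v n \<and> R *\<^sub>v x = 0\<^sub>v n"
proof
  assume zero: "(E - J + R) *\<^sub>v x = 0\<^sub>v n"
  have psd: "psd_mat n E" "psd_mat n R" using triple unfolding dissipative_triple_def by auto
  have "x \<bullet> (E *\<^sub>v x) + x \<bullet> (R *\<^sub>v x) = 0"
    using dissipative_scalar_prod_self(2)[OF x] zero x by simp
  moreover have "0 \<le> x \<bullet> (E *\<^sub>v x)" "0 \<le> x \<bullet> (R *\<^sub>v x)" using psd x unfolding psd_mat_def by auto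
  ultimately have "x \<bullet> (E *\<^sub>v x) = 0" "x \<bullet> (R *\<^sub>v x) = 0" by linarith+
  then have E: "E *\<^sub>v x = 0\<^sub>v n" and R: "R *\<^sub>v x = 0\<^sub>v n"
    using psd_scalar_prod_eq_0 psd x by blast+
  have J: "0\<^sub>v n - J *\<^sub>v x + 0\<^sub>v n = 0\<^sub>v n" using zero unfolding dissipative_apply[OF x] E R .
  have "J *\<^sub>v x = 0\<^sub>v n"
  proof (rule eq_vecI)
    fix i assume "i < dim_vec (0\<^sub>v n :: real vec)"
    then show "(J *\<^sub>v x) $ i = 0\<^sub>v n $ i"
      using arg_cong[OF J, of "\<lambda>v. v $ i"] dissipative_carriers(2) by (simp del: index_mult_mat_vec)
  qed (use dissipative_carriers(2) in simp)
  with E R show "E *\<^sub>v x = 0\<^sub>v n \<and> J *\<^sub>v x = 0\<^sub>v n \<and> R *\<^sub>v x = 0\<^sub>v n" by blast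
next
  assume "E *\<^sub>v x = 0\<^sub>v n \<and> J *\<^sub>v x = 0\<^sub>v n \<and> R *\<^sub>v x = 0\<^sub>v n"
  then show "(E - J + R) *\<^sub>v x = 0\<^sub>v n" unfolding dissipative_apply[OF x] by simp
qed

text \<open>
  \<open>x\<^sub>0\<^sup>T R x\<^sub>0 = - x\<^sub>0\<^sup>T (J - R) x\<^sub>0 = - x\<^sub>0\<^sup>T E x\<^sub>1 = - x\<^sub>1\<^sup>T E x\<^sub>0 = 0\<close>.
\<close>

lemma dissipative_chain_start:
  assumes x: "x 0 \<in> carrier_vec n" "x 1 \<in> carrier_vec n"
    and x0: "E *\<^sub>v x 0 = 0\<^sub>v n" and x1: "E *\<^sub>v x 1 = (J - R) *\<^sub>v x 0"
  shows "R *\<^sub>v x 0 = 0\<^sub>v n"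
proof -
  have psd: "psd_mat n R" using triple unfolding dissipative_triple_def by auto
  have "x 0 \<bullet> ((J - R) *\<^sub>v x 0) = x 1 \<bullet> (E *\<^sub>v x 0)"
    unfolding x1[symmetric] using symmetric_scalar_prod[OF dissipative_carriers(1) dissipative_transpose(1) x] .
  then have "x 0 \<bullet> (R *\<^sub>v x 0) = 0" using x x0 by (simp add: dissipative_scalar_prod_self)
  then show ?thesis by (rule psd_scalar_prod_eq_0[OF psd x(1)])
qed

text \<open>
  The reason behind both the bound two on the index and the vanishing of the minimal indices.
\<close>

lemma dissipative_no_long_chain: "\<not> infinity_chain E (J - R) 2"
proof
  assume "infinity_chain E (J - R) 2"
  then obtain x where x': "\<And>i. i \<le> 2 \<Longrightarrow> x i \<in> carrier_vec n"
    and x0: "E *\<^sub>v x 0 = 0\<^sub>v n" and xs: "\<And>i. i < 2 \<Longrightarrow> E *\<^sub>v x (Suc i) = (J - R) *\<^sub>v x i"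
    and nz: "(J - R) *\<^sub>v x 0 \<noteq> 0\<^sub>v n"
    using dissipative_carriers unfolding infinity_chain_def by auto
  have x: "x 0 \<in> carrier_vec n" "x 1 \<in> carrier_vec n" "x 2 \<in> carrier_vec n" using x' by auto
  have x1: "E *\<^sub>v x 1 = (J - R) *\<^sub>v x 0" and x2: "E *\<^sub>v x 2 = (J - R) *\<^sub>v x 1"
    using xs[of 0] xs[of 1] by (simp_all add: numeral_2_eq_2)
  have psd: "psd_mat n E" "psd_mat n R" "skew_mat n J" "transpose_mat R = R"
    using triple unfolding dissipative_triple_def psd_mat_def by auto
  note carr = dissipative_carriers
  have R: "R *\<^sub>v x 0 = 0\<^sub>v n" by (rule dissipative_chain_start[OF x(1,2) x0 x1])
  have "0 = x 2 \<bullet> (E *\<^sub>v x 0)" using x x0 by simp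
  also have "\<dots> = x 0 \<bullet> (E *\<^sub>v x 2)"
    by (rule symmetric_scalar_prod[OF carr(1) dissipative_transpose(1) x(3,1)])
  also have "\<dots> = x 0 \<bullet> (J *\<^sub>v x 1) - x 0 \<bullet> (R *\<^sub>v x 1)"
    unfolding x2 dissipative_apply[OF x(2)] using x carr by (simp add: scalar_prod_minus_distrib[of _ n])
  also have "x 0 \<bullet> (R *\<^sub>v x 1) = 0"
    using symmetric_scalar_prod[OF carr(3) psd(4) x(1,2)] R x by simp
  finally have "x 0 \<bullet> (J *\<^sub>v x 1) = 0" by simp
  then have "x 1 \<bullet> (J *\<^sub>v x 0) = 0" using skew_scalar_prod[OF psd(3) x(1,2)] by simp
  moreover have Ex1: "E *\<^sub>v x 1 = J *\<^sub>v x 0"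
    unfolding x1 dissipative_apply[OF x(1)] R using x carr by simp
  ultimately have "E *\<^sub>v x 1 = 0\<^sub>v n" using psd_scalar_prod_eq_0[OF psd(1) x(2)] by simp
  then show False using nz x1 by simp
qed

end

text \<open>
  Real and imaginary parts of a complex chain satisfy the real chain equations, and at least one of
  them keeps \<open>A x\<^sub>0 \<noteq> 0\<close>.
\<close>

lemma infinity_chain_complexify_iff:
  assumes E: "E \<in> carrier_mat r c" and A: "A \<in> carrier_mat r c"
  shows "infinity_chain (complexify E) (complexify A) k \<longleftrightarrow> infinity_chain E A k"
proof
  have dims: "dim_row E = r" "dim_col E = c" "dim_row A = r" using E A by auto
  have dims': "dim_row (complexify E) = r" "dim_col (complexify E) = c" "dim_row (complexify A) = r" using E A by auto
  assume "infinity_chain (complexify E) (complexify A) k"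
  then obtain x where x: "\<And>i. i \<le> k \<Longrightarrow> x i \<in> carrier_vec c"
    and x0: "complexify E *\<^sub>v x 0 = 0\<^sub>v r" and xs: "\<And>i. i < k \<Longrightarrow> complexify E *\<^sub>v x (Suc i) = complexify A *\<^sub>v x i"
    and nz: "complexify A *\<^sub>v x 0 \<noteq> 0\<^sub>v r"
    unfolding infinity_chain_def dims' by blast
  have Re: "map_vec Re (complexify M *\<^sub>v v) = M *\<^sub>v map_vec Re v"
    and Im: "map_vec Im (complexify M *\<^sub>v v) = M *\<^sub>v map_vec Im v"
    if "M \<in> carrier_mat r c" "v \<in> carrier_vec c" for M v
    using that by (auto intro!: eq_vecI simp: scalar_prod_def)
  have chain: "infinity_chain E A k"
    if f: "\<And>M v. M \<in> carrier_mat r c \<Longrightarrow> v \<in> carrier_vec c \<Longrightarrow> map_vec f (complexify M *\<^sub>v v) = M *\<^sub>v map_vec f v"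
      and f0: "f 0 = 0" and ne: "map_vec f (complexify A *\<^sub>v x 0) \<noteq> 0\<^sub>v r" for f :: "complex \<Rightarrow> real"
    unfolding infinity_chain_def dims
  proof (rule exI[of _ "\<lambda>i. map_vec f (x i)"], intro conjI allI impI)
    have "map_vec f (0\<^sub>v r) = 0\<^sub>v r" using f0 by (intro eq_vecI) auto
    then show "E *\<^sub>v map_vec f (x 0) = 0\<^sub>v r" using f[OF E x[of 0]] x0 by simp
    show "E *\<^sub>v map_vec f (x (Suc i)) = A *\<^sub>v map_vec f (x i)" if "i < k" for i
      using f[OF E x[of "Suc i"]] f[OF A x[of i]] xs[OF that] that by simp
    show "A *\<^sub>v map_vec f (x 0) \<noteq> 0\<^sub>v r" using f[OF A x[of 0]] ne by simp
  qed (use x in auto)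
  obtain i where i: "i < r" "(complexify A *\<^sub>v x 0) $ i \<noteq> 0"
  proof (rule ccontr)
    assume "\<not> thesis"
    then have "complexify A *\<^sub>v x 0 = 0\<^sub>v r" using that A by (intro eq_vecI) auto
    with nz show False by simp
  qed
  define v where "v = complexify A *\<^sub>v x 0"
  have v: "dim_vec v = r" using A by (simp add: v_def)
  have "Re (v $ i) \<noteq> 0 \<or> Im (v $ i) \<noteq> 0" using i(2) complex_eqI[of "v $ i" 0] by (auto simp: v_def)
  then have "map_vec Re v $ i \<noteq> 0\<^sub>v r $ i \<or> map_vec Im v $ i \<noteq> 0\<^sub>v r $ i" using v i(1) by simp
  then have "map_vec Re v \<noteq> 0\<^sub>v r \<or> map_vec Im v \<noteq> 0\<^sub>v r" by metis
  then show "infinity_chain E A k" using chain[of Re] chain[of Im] Re Im by (auto simp: v_def)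
next
  have dims: "dim_row E = r" "dim_col E = c" "dim_row A = r" using E A by auto
  have dims': "dim_row (complexify E) = r" "dim_col (complexify E) = c" "dim_row (complexify A) = r" using E A by auto
  assume "infinity_chain E A k"
  then obtain x where x: "\<And>i. i \<le> k \<Longrightarrow> x i \<in> carrier_vec c"
    and x0: "E *\<^sub>v x 0 = 0\<^sub>v r" and xs: "\<And>i. i < k \<Longrightarrow> E *\<^sub>v x (Suc i) = A *\<^sub>v x i"
    and nz: "A *\<^sub>v x 0 \<noteq> 0\<^sub>v r"
    unfolding infinity_chain_def dims by blast
  note hom = of_real_hom.mult_mat_vec_hom[where 'a = complex, symmetric]
  show "infinity_chain (complexify E) (complexify A) k"
    unfolding infinity_chain_def dims'
  proof (rule exI[of _ "\<lambda>i. map_vec complex_of_real (x i)"], intro conjI allI impI)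
    show "complexify E *\<^sub>v map_vec complex_of_real (x 0) = 0\<^sub>v r"
      using hom[OF E x[of 0]] x0 by (simp add: of_real_hom.vec_hom_zero)
    show "complexify E *\<^sub>v map_vec complex_of_real (x (Suc i)) = complexify A *\<^sub>v map_vec complex_of_real (x i)"
      if "i < k" for i
      using hom[OF E x[of "Suc i"]] hom[OF A x[of i]] xs[OF that] that by simp
    show "complexify A *\<^sub>v map_vec complex_of_real (x 0) \<noteq> 0\<^sub>v r"
      using hom[OF A x[of 0]] nz by (simp add: of_real_hom.vec_hom_zero_iff)
  qed (use x in auto)
qed

section \<open>Orthogonal deflation of the common kernel\<close>

lemma transpose_congruence:
  fixes M :: "'a::comm_semiring_0 mat"
  assumes M: "M \<in> carrier_mat n n" and U: "U \<in> carrier_mat n m"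
  shows "transpose_mat (transpose_mat U * M * U) = transpose_mat U * transpose_mat M * U"
proof -
  have UM: "transpose_mat U * M \<in> carrier_mat m n" using M U by simp
  have "transpose_mat (transpose_mat U * M * U) = transpose_mat U * (transpose_mat M * U)"
    using transpose_mult[OF UM U] transpose_mult[of "transpose_mat U" m n M n] M U by simp
  also have "\<dots> = transpose_mat U * transpose_mat M * U"
    by (rule assoc_mult_mat[symmetric, of _ m n _ n _ m]) (use M U in auto)
  finally show ?thesis .
qed

lemma congruence_apply:
  fixes M :: "'a::comm_semiring_0 mat"
  assumes M: "M \<in> carrier_mat n n" and U: "U \<in> carrier_mat n m" and x: "x \<in> carrier_vec m"
  shows "(transpose_mat U * M * U) *\<^sub>v x = transpose_mat U *\<^sub>v (M *\<^sub>v (U *\<^sub>v x))"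
  using assoc_mult_mat_vec[of "transpose_mat U * M" m n U m x]
    assoc_mult_mat_vec[of "transpose_mat U" m n M n "U *\<^sub>v x"] M U x by simp

lemma congruence_add:
  fixes M N :: "'a::comm_ring_1 mat"
  assumes "M \<in> carrier_mat n n" "N \<in> carrier_mat n n" "U \<in> carrier_mat n m"
  shows "transpose_mat U * (M + N) * U = transpose_mat U * M * U + transpose_mat U * N * U"
    "transpose_mat U * (M - N) * U = transpose_mat U * M * U - transpose_mat U * N * U"
  using assms mult_add_distrib_mat[of "transpose_mat U" m n M n N]
    add_mult_distrib_mat[of "transpose_mat U * M" m n "transpose_mat U * N" U m]
    mult_minus_distrib_mat[of "transpose_mat U" m n M n N]
    minus_mult_distrib_mat[of "transpose_mat U * M" m n "transpose_mat U * N" U m] by auto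

lemma psd_congruence:
  assumes S: "psd_mat n S" and U: "U \<in> carrier_mat n m"
  shows "psd_mat m (transpose_mat U * S * U)"
proof -
  have carr: "S \<in> carrier_mat n n" and sym: "transpose_mat S = S"
    and nonneg: "\<And>x. x \<in> carrier_vec n \<Longrightarrow> 0 \<le> x \<bullet> (S *\<^sub>v x)" using S unfolding psd_mat_def by auto
  have "0 \<le> x \<bullet> ((transpose_mat U * S * U) *\<^sub>v x)" if x: "x \<in> carrier_vec m" for x
  proof -
    have "x \<bullet> ((transpose_mat U * S * U) *\<^sub>v x) = (U *\<^sub>v x) \<bullet> (S *\<^sub>v (U *\<^sub>v x))"
      unfolding congruence_apply[OF carr U x]
      using transpose_vec_mult_scalar[of "transpose_mat U" m n "S *\<^sub>v (U *\<^sub>v x)" x] carr U x by simp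
    then show ?thesis using nonneg[of "U *\<^sub>v x"] U x by simp
  qed
  then show ?thesis unfolding psd_mat_def transpose_congruence[OF carr U] sym using carr U by auto
qed

lemma skew_congruence:
  assumes J: "skew_mat n J" and U: "U \<in> carrier_mat n m"
  shows "skew_mat m (transpose_mat U * J * U)"
proof -
  have carr: "J \<in> carrier_mat n n" and "J = - transpose_mat J" using J unfolding skew_mat_def by auto
  then have T: "transpose_mat J = - J" by (metis uminus_uminus_mat)
  have "transpose_mat U * - J * U = - (transpose_mat U * J * U)"
    using carr U by simp
  then have "transpose_mat (transpose_mat U * J * U) = - (transpose_mat U * J * U)"
    unfolding transpose_congruence[OF carr U] T .
  then show ?thesis using carr U unfolding skew_mat_def by simp
qed

lemma dissipative_congruence:
  assumes "dissipative_triple n E J R" "U \<in> carrier_mat n m"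
  shows "dissipative_triple m (transpose_mat U * E * U) (transpose_mat U * J * U) (transpose_mat U * R * U)"
  using assms psd_congruence skew_congruence unfolding dissipative_triple_def by blast

lemma leading_block_congruence:
  fixes A B :: "'a::comm_semiring_1 mat"
  assumes A: "A \<in> carrier_mat m m" and B: "B \<in> carrier_mat r r"
    and I: "I = four_block_mat (1\<^sub>m m) (0\<^sub>m m 0) (0\<^sub>m r m) (0\<^sub>m r 0)"
  shows "transpose_mat I * direct_sum_mat A B * I = A"
proof -
  have T: "transpose_mat I = four_block_mat (1\<^sub>m m) (0\<^sub>m m r) (0\<^sub>m 0 m) (0\<^sub>m 0 r)"
    unfolding I by (intro eq_matI) auto
  have "transpose_mat I * direct_sum_mat A B = four_block_mat A (0\<^sub>m m r) (0\<^sub>m 0 m) (0\<^sub>m 0 r)"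
    unfolding T using A B by (subst mult_four_block_mat[of _ m m _ r _ 0 _ _ m _ r]) auto
  also have "\<dots> * I = four_block_mat A (0\<^sub>m m 0) (0\<^sub>m 0 m) (0\<^sub>m 0 0)"
    unfolding I using A by (subst mult_four_block_mat[of _ m m _ r _ 0 _ _ m _ 0]) auto
  also have "\<dots> = A" by (intro eq_matI) (use A in auto)
  finally show ?thesis .
qed

text \<open>
  The leading block is a congruence of the whole matrix by the (nonsquare) inclusion of the first
  \<open>m\<close> coordinates.
\<close>

lemma dissipative_direct_sumD:
  assumes "dissipative_triple (m + r) (direct_sum_mat E1 E2) (direct_sum_mat J1 J2) (direct_sum_mat R1 R2)"
    and "E1 \<in> carrier_mat m m" "J1 \<in> carrier_mat m m" "R1 \<in> carrier_mat m m"
    and "E2 \<in> carrier_mat r r" "J2 \<in> carrier_mat r r" "R2 \<in> carrier_mat r r"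
  shows "dissipative_triple m E1 J1 R1"
proof -
  define I :: "real mat" where "I = four_block_mat (1\<^sub>m m) (0\<^sub>m m 0) (0\<^sub>m r m) (0\<^sub>m r 0)"
  have "I \<in> carrier_mat (m + r) m" unfolding I_def by (intro carrier_matI) auto
  from dissipative_congruence[OF assms(1) this] show ?thesis
    by (simp only: leading_block_congruence[OF assms(2,5) I_def]
      leading_block_congruence[OF assms(3,6) I_def] leading_block_congruence[OF assms(4,7) I_def])
qed

text \<open>
  Unless \<open>v\<close> is the last unit vector \<open>e\<close> itself, the reflection in the hyperplane orthogonal to
  \<open>w = e - v\<close> exchanges \<open>e\<close> and \<open>v\<close>.
\<close>

lemma householder:
  fixes v :: "real vec"
  assumes v: "v \<in> carrier_vec (Suc n)" and unit: "v \<bullet> v = 1"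
  shows "\<exists>U. real_orthogonal_mat (Suc n) U \<and> U *\<^sub>v unit_vec (Suc n) n = v"
proof (cases "v = unit_vec (Suc n) n")
  case True
  then show ?thesis by (intro exI[of _ "1\<^sub>m (Suc n)"]) (auto simp: real_orthogonal_mat_def)
next
  case False
  let ?N = "Suc n"
  define e :: "real vec" where "e = unit_vec ?N n"
  define w where "w = e - v"
  have e: "e \<in> carrier_vec ?N" by (simp add: e_def)
  have w: "w \<in> carrier_vec ?N" using v by (simp add: w_def e_def)
  have ev: "e \<bullet> v = v $ n" using v by (simp add: e_def)
  have ee: "e \<bullet> e = 1" by (simp add: e_def)
  have we: "w \<bullet> e = 1 - v $ n"
    unfolding w_def minus_scalar_prod_distrib[OF e v e] ee using ev comm_scalar_prod[OF e v] by simp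
  have wv: "w \<bullet> v = v $ n - 1"
    unfolding w_def minus_scalar_prod_distrib[OF e v v] unit ev by simp
  have ww: "w \<bullet> w = 2 * (1 - v $ n)"
    using scalar_prod_minus_distrib[OF w e v] we wv by (simp add: w_def)
  have "w \<bullet> w \<noteq> 0"
  proof
    assume "w \<bullet> w = 0"
    then have w0: "w = 0\<^sub>v ?N" by (rule real_scalar_prod_self_eq_0[OF _ w])
    have "v = e"
    proof (rule eq_vecI)
      fix i assume "i < dim_vec e"
      then show "v $ i = e $ i" using arg_cong[OF w0, of "\<lambda>x. x $ i"] v by (simp add: w_def e_def)
    qed (use v in \<open>simp add: e_def\<close>)
    with False show False by (simp add: e_def)
  qed
  then have vn: "1 - v $ n \<noteq> 0" using ww by simp
  \<comment> \<open>This is \<open>2 / (w \<bullet> w)\<close>, the factor in the reflection \<open>I - c w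
     w\<^sup>T\<close>.\<close>
  define c where "c = 1 / (1 - v $ n)"
  have c: "c * (w \<bullet> w) = 2" "c * (w \<bullet> e) = 1" using vn by (simp_all add: c_def ww we nonzero_divide_eq_eq)
  define U where "U = mat ?N ?N (\<lambda>(i, j). (if i = j then 1 else 0) - c * w $ i * w $ j)"
  have U: "U \<in> carrier_mat ?N ?N" by (simp add: U_def)
  have TU: "transpose_mat U = U" by (intro eq_matI) (auto simp: U_def)
  have reflect: "U *\<^sub>v x = x - (c * (w \<bullet> x)) \<cdot>\<^sub>v w" if x: "x \<in> carrier_vec ?N" for x
  proof (rule eq_vecI)
    fix i assume "i < dim_vec (x - (c * (w \<bullet> x)) \<cdot>\<^sub>v w)"
    then have i: "i < ?N" using w by simp
    have "(U *\<^sub>v x) $ i = (\<Sum>j = 0..<?N. U $$ (i, j) * x $ j)"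
      using i x U by (simp add: scalar_prod_def)
    also have "\<dots> = (\<Sum>j = 0..<?N. (if j = i then x $ j else 0) - c * w $ i * (w $ j * x $ j))"
      using i by (intro sum.cong) (auto simp: U_def algebra_simps)
    also have "\<dots> = x $ i - c * w $ i * (w \<bullet> x)"
      using i x by (simp add: sum_subtractf sum_distrib_left[symmetric] scalar_prod_def del: sum.op_ivl_Suc)
    finally show "(U *\<^sub>v x) $ i = (x - (c * (w \<bullet> x)) \<cdot>\<^sub>v w) $ i" using i x w by simp
  qed (use U w in simp)
  have "U * U = 1\<^sub>m ?N"
  proof (rule eq_matI)
    fix i j assume "i < dim_row (1\<^sub>m ?N :: real mat)" "j < dim_col (1\<^sub>m ?N :: real mat)"
    then have ij: "i < ?N" "j < ?N" by simp_all
    define x :: "real vec" where "x = unit_vec ?N j"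
    have x: "x \<in> carrier_vec ?N" by (simp add: x_def)
    define a where "a = c * (w \<bullet> x)"
    have "w \<bullet> (x - a \<cdot>\<^sub>v w) = w \<bullet> x - a * (w \<bullet> w)"
      using scalar_prod_minus_distrib[OF w x, of "a \<cdot>\<^sub>v w"] w by simp
    then have "c * (w \<bullet> (x - a \<cdot>\<^sub>v w)) = c * (w \<bullet> x) - a * (c * (w \<bullet> w))" by (simp add: right_diff_distrib)
    then have ca: "c * (w \<bullet> (x - a \<cdot>\<^sub>v w)) = - a" unfolding c a_def by simp
    have "U *\<^sub>v (U *\<^sub>v x) = (x - a \<cdot>\<^sub>v w) - (- a) \<cdot>\<^sub>v w"
      using reflect[OF x] reflect[of "x - a \<cdot>\<^sub>v w"] x w ca by (simp add: a_def)
    also have "\<dots> = x" by (intro eq_vecI) (use x w in auto)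
    finally have "U *\<^sub>v (U *\<^sub>v x) = x" .
    moreover have "(U * U) *\<^sub>v x = U *\<^sub>v (U *\<^sub>v x)" by (rule assoc_mult_mat_vec[OF U U x])
    moreover have "(V *\<^sub>v x) $ i = V $$ (i, j)" if "V \<in> carrier_mat ?N ?N" for V
      using ij that by (simp add: x_def)
    then have "((U * U) *\<^sub>v x) $ i = (U * U) $$ (i, j)" using U by (metis mult_carrier_mat)
    ultimately show "(U * U) $$ (i, j) = 1\<^sub>m ?N $$ (i, j)" using ij by (simp add: x_def del: index_mult_mat(1))
  qed (use U in auto)
  moreover have "U *\<^sub>v e = v"
  proof -
    have "U *\<^sub>v e = e - 1 \<cdot>\<^sub>v w" using reflect[OF e] c by simp
    also have "\<dots> = v" by (intro eq_vecI) (use e v in \<open>auto simp: w_def\<close>)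
    finally show ?thesis .
  qed
  ultimately show ?thesis using U TU by (intro exI[of _ U]) (simp add: real_orthogonal_mat_def e_def)
qed

lemma trailing_zero_direct_sum:
  fixes M :: "'a::semiring_1 mat"
  assumes M: "M \<in> carrier_mat (Suc n) (Suc n)"
    and col: "M *\<^sub>v unit_vec (Suc n) n = 0\<^sub>v (Suc n)" and row: "transpose_mat M *\<^sub>v unit_vec (Suc n) n = 0\<^sub>v (Suc n)"
  shows "\<exists>A \<in> carrier_mat n n. M = direct_sum_mat A (0\<^sub>m 1 1)"
proof
  define A where "A = mat n n (\<lambda>ij. M $$ ij)"
  show "A \<in> carrier_mat n n" by (simp add: A_def)
  have c: "M $$ (i, n) = 0" and r: "M $$ (n, i) = 0" if "i < Suc n" for i
    using arg_cong[OF col, of "\<lambda>v. v $ i"] arg_cong[OF row, of "\<lambda>v. v $ i"] M that by auto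
  have idx: "i = n" if "\<not> i < n" "i < Suc n" for i using that by simp
  show "M = direct_sum_mat A (0\<^sub>m 1 1)"
    by (intro eq_matI) (use M in \<open>auto simp: A_def dest!: idx intro: c r\<close>)
qed

lemma direct_sum_mat_assoc_zero:
  assumes "A \<in> carrier_mat m m"
  shows "direct_sum_mat (direct_sum_mat A (0\<^sub>m r r)) (0\<^sub>m s s) = direct_sum_mat A (0\<^sub>m (r + s) (r + s))"
  by (intro eq_matI) (use assms in auto)

lemma real_kernel_unit_vector:
  fixes M :: "real mat"
  assumes M: "M \<in> carrier_mat n n" and det: "det M = 0"
  obtains v where "v \<in> carrier_vec n" "v \<bullet> v = 1" "M *\<^sub>v v = 0\<^sub>v n"
proof -
  obtain x where x: "x \<in> carrier_vec n" "x \<noteq> 0\<^sub>v n" "M *\<^sub>v x = 0\<^sub>v n"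
    using det det_0_iff_vec_prod_zero[OF M] by blast
  have "0 < x \<bullet> x" using real_scalar_prod_self_ge_0[of x] real_scalar_prod_self_eq_0[of x n] x by fastforce
  then have "(1 / sqrt (x \<bullet> x) \<cdot>\<^sub>v x) \<bullet> (1 / sqrt (x \<bullet> x) \<cdot>\<^sub>v x) = 1"
    using x by (simp add: field_simps)
  moreover have "M *\<^sub>v (1 / sqrt (x \<bullet> x) \<cdot>\<^sub>v x) = 0\<^sub>v n"
    unfolding mult_mat_vec[OF M x(1)] x(3) by (intro eq_vecI) auto
  ultimately show thesis using that[of "1 / sqrt (x \<bullet> x) \<cdot>\<^sub>v x"] x(1) by simp
qed

text \<open>
  Induction on the size. If \<open>E - J + R\<close> is singular, all three matrices annihilate a unit vector \<open>v\<close>, and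
  an orthogonal matrix with last column \<open>v\<close> gives each of them a zero last row and column; the
  leading blocks are again of the given structure.
\<close>

lemma dissipative_deflation:
  assumes "dissipative_triple n E J R"
  shows "\<exists>m r U E1 J1 R1. n = m + r \<and> real_orthogonal_mat n U \<and> dissipative_triple m E1 J1 R1 \<and>
    det (E1 - J1 + R1) \<noteq> 0 \<and> transpose_mat U * E * U = direct_sum_mat E1 (0\<^sub>m r r) \<and>
    transpose_mat U * J * U = direct_sum_mat J1 (0\<^sub>m r r) \<and> transpose_mat U * R * U = direct_sum_mat R1 (0\<^sub>m r r)"
  using assms
proof (induction n arbitrary: E J R rule: less_induct)
  case (less n)
  note carr = dissipative_carriers[OF less.prems]
  show ?case
  proof (cases "det (E - J + R) = 0")
    case False
    have trivial: "transpose_mat (1\<^sub>m n) * X * 1\<^sub>m n = direct_sum_mat X (0\<^sub>m 0 0)" if "X \<in> carrier_mat n n" for X :: "real mat"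
      by (intro eq_matI) (use that in auto)
    show ?thesis
      by (rule exI[of _ n], rule exI[of _ 0], rule exI[of _ "1\<^sub>m n"], rule exI[of _ E], rule exI[of _ J], rule exI[of _ R])
        (use False less.prems carr trivial in \<open>simp add: real_orthogonal_mat_def\<close>)
  next
    case True
    then have "n \<noteq> 0" using det_dim_zero[of "E - J + R"] carr(5) by auto
    then obtain n' where n: "n = Suc n'" using not0_implies_Suc by blast
    obtain v where v: "v \<in> carrier_vec n" "v \<bullet> v = 1" "(E - J + R) *\<^sub>v v = 0\<^sub>v n"
      using real_kernel_unit_vector[OF carr(5) True] .
    have kernel: "E *\<^sub>v v = 0\<^sub>v n" "J *\<^sub>v v = 0\<^sub>v n" "R *\<^sub>v v = 0\<^sub>v n"
      using v dissipative_kernel_iff[OF less.prems] by auto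
    obtain U where "real_orthogonal_mat n U" and Ue: "U *\<^sub>v unit_vec n n' = v"
      using householder[of v n'] v n by auto
    then have U: "U \<in> carrier_mat n n" and UU: "transpose_mat U * U = 1\<^sub>m n" unfolding real_orthogonal_mat_def by auto
    note triple = dissipative_congruence[OF less.prems U]
    have e: "unit_vec n n' \<in> carrier_vec n" by simp
    have split: "\<exists>A \<in> carrier_mat n' n'. transpose_mat U * X * U = direct_sum_mat A (0\<^sub>m 1 1)"
      if X: "X \<in> carrier_mat n n" and sym: "transpose_mat X = X \<or> transpose_mat X = - X" and Xv: "X *\<^sub>v v = 0\<^sub>v n" for X
    proof -
      have TX: "transpose_mat X *\<^sub>v v = 0\<^sub>v n"
      proof (rule disjE[OF sym])
        assume "transpose_mat X = - X"
        moreover have "- X *\<^sub>v v = - (X *\<^sub>v v)" using X v by simp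
        ultimately show ?thesis using Xv by simp
      qed (use Xv in simp)
      have carrT: "transpose_mat X \<in> carrier_mat n n" using X by simp
      have "(transpose_mat U * X * U) *\<^sub>v unit_vec n n' = 0\<^sub>v n"
        unfolding congruence_apply[OF X U e] Ue Xv by (rule mult_mat_vec_zero) (use U in simp)
      moreover have "transpose_mat (transpose_mat U * X * U) *\<^sub>v unit_vec n n' = 0\<^sub>v n"
        unfolding transpose_congruence[OF X U] congruence_apply[OF carrT U e] Ue TX
        by (rule mult_mat_vec_zero) (use U in simp)
      ultimately show ?thesis using trailing_zero_direct_sum[of "transpose_mat U * X * U" n'] X U unfolding n by auto
    qed
    have syms: "transpose_mat E = E" "transpose_mat J = - J" "transpose_mat R = R"
      using less.prems unfolding dissipative_triple_def psd_mat_def skew_mat_def by (auto, metis uminus_uminus_mat)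
    obtain E' where E': "E' \<in> carrier_mat n' n'" "transpose_mat U * E * U = direct_sum_mat E' (0\<^sub>m 1 1)"
      using split[OF carr(1)] syms kernel by auto
    obtain J' where J': "J' \<in> carrier_mat n' n'" "transpose_mat U * J * U = direct_sum_mat J' (0\<^sub>m 1 1)"
      using split[OF carr(2)] syms kernel by auto
    obtain R' where R': "R' \<in> carrier_mat n' n'" "transpose_mat U * R * U = direct_sum_mat R' (0\<^sub>m 1 1)"
      using split[OF carr(3)] syms kernel by auto
    have "dissipative_triple (n' + 1) (direct_sum_mat E' (0\<^sub>m 1 1)) (direct_sum_mat J' (0\<^sub>m 1 1)) (direct_sum_mat R' (0\<^sub>m 1 1))"
      using triple unfolding E'(2) J'(2) R'(2) by (simp add: n)
    then have "dissipative_triple n' E' J' R'"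
      by (rule dissipative_direct_sumD) (use E' J' R' in auto)
    from less.IH[OF _ this] n obtain m r V E1 J1 R1 where mr: "n' = m + r" and V: "real_orthogonal_mat n' V"
      and triple1: "dissipative_triple m E1 J1 R1" and det1: "det (E1 - J1 + R1) \<noteq> 0"
      and eqs: "transpose_mat V * E' * V = direct_sum_mat E1 (0\<^sub>m r r)"
        "transpose_mat V * J' * V = direct_sum_mat J1 (0\<^sub>m r r)" "transpose_mat V * R' * V = direct_sum_mat R1 (0\<^sub>m r r)"
      by blast
    have V: "V \<in> carrier_mat n' n'" "transpose_mat V * V = 1\<^sub>m n'" using V unfolding real_orthogonal_mat_def by auto
    note carr1 = dissipative_carriers[OF triple1]
    define W where "W = direct_sum_mat V (1\<^sub>m 1)"
    have W: "W \<in> carrier_mat n n" using V unfolding W_def n by (intro carrier_matI) auto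
    have TW: "transpose_mat W = direct_sum_mat (transpose_mat V) (1\<^sub>m 1)"
      unfolding W_def by (intro eq_matI) auto
    have WW: "transpose_mat W * W = 1\<^sub>m n"
      unfolding TW unfolding W_def using direct_sum_mat_mult[of "transpose_mat V" n' n' V n' "1\<^sub>m 1" 1 1 "1\<^sub>m 1" 1] V n by simp
    have UW: "U * W \<in> carrier_mat n n" using U W by simp
    have TUW: "transpose_mat (U * W) = transpose_mat W * transpose_mat U" by (rule transpose_mult[OF U W])
    have "transpose_mat W * (transpose_mat U * U) * W = transpose_mat (U * W) * (U * W)"
      unfolding TUW using U W by (simp add: assoc_mult_mat[of _ n n _ n _ n])
    then have orth: "real_orthogonal_mat n (U * W)"
      unfolding real_orthogonal_mat_def using UU WW W UW by simp
    have step: "transpose_mat (U * W) * X * (U * W) = direct_sum_mat X1 (0\<^sub>m (Suc r) (Suc r))"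
      if X: "X \<in> carrier_mat n n" and X': "X' \<in> carrier_mat n' n'" and X1: "X1 \<in> carrier_mat m m"
        and 1: "transpose_mat U * X * U = direct_sum_mat X' (0\<^sub>m 1 1)"
        and 2: "transpose_mat V * X' * V = direct_sum_mat X1 (0\<^sub>m r r)" for X X' X1
    proof -
      have "transpose_mat (U * W) * X * (U * W) = transpose_mat W * (transpose_mat U * X * U) * W"
        unfolding TUW using mat_sandwich_sandwich[OF X, of "transpose_mat U" "transpose_mat W" U W] U W by simp
      also have "transpose_mat W * (transpose_mat U * X * U) = direct_sum_mat (transpose_mat V * X') (1\<^sub>m 1 * 0\<^sub>m 1 1)"
        unfolding TW 1 by (rule direct_sum_mat_mult) (use V X' in auto)
      also have "\<dots> * W = direct_sum_mat (transpose_mat V * X' * V) (1\<^sub>m 1 * 0\<^sub>m 1 1 * 1\<^sub>m 1)"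
        unfolding W_def by (rule direct_sum_mat_mult) (use V X' in auto)
      also have "\<dots> = direct_sum_mat (direct_sum_mat X1 (0\<^sub>m r r)) (0\<^sub>m 1 1)" unfolding 2 by simp
      also have "\<dots> = direct_sum_mat X1 (0\<^sub>m (Suc r) (Suc r))" using direct_sum_mat_assoc_zero[OF X1, of r 1] by simp
      finally show ?thesis .
    qed
    show ?thesis
    proof (rule exI[of _ m], rule exI[of _ "Suc r"], rule exI[of _ "U * W"], rule exI[of _ E1],
        rule exI[of _ J1], rule exI[of _ R1], intro conjI)
      show "n = m + Suc r" using n mr by simp
    qed (fact orth triple1 det1 step[OF carr(1) E'(1) carr1(1) E'(2) eqs(1)]
          step[OF carr(2) J'(1) carr1(2) J'(2) eqs(2)] step[OF carr(3) R'(1) carr1(3) R'(2) eqs(3)])+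
  qed
qed

section \<open>Regularity, kernel dimension and index of dissipative pencils\<close>

lemma smult_mat_mult_vec:
  fixes M :: "'a::comm_semiring_0 mat"
  assumes "M \<in> carrier_mat nr nc" "x \<in> carrier_vec nc"
  shows "(a \<cdot>\<^sub>m M) *\<^sub>v x = a \<cdot>\<^sub>v (M *\<^sub>v x)"
  using assms by (intro eq_vecI) (auto simp: scalar_prod_def sum_distrib_left mult.assoc)

lemma dissipative_common_kernel_iff:
  assumes triple: "dissipative_triple n E J R"
  shows "mat_kernel J \<inter> mat_kernel E \<inter> mat_kernel R \<noteq> {0\<^sub>v n} \<longleftrightarrow> det (E - J + R) = 0"
proof -
  note carr = dissipative_carriers[OF triple]
  have "mat_kernel J \<inter> mat_kernel E \<inter> mat_kernel R = mat_kernel (E - J + R)"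
    unfolding mat_kernel[OF carr(1)] mat_kernel[OF carr(2)] mat_kernel[OF carr(3)] mat_kernel[OF carr(5)]
    using dissipative_kernel_iff[OF triple] by auto
  also have "\<dots> \<noteq> {0\<^sub>v n} \<longleftrightarrow> (\<exists>v. v \<in> carrier_vec n \<and> v \<noteq> 0\<^sub>v n \<and> (E - J + R) *\<^sub>v v = 0\<^sub>v n)"
    unfolding mat_kernel[OF carr(5)] using mult_mat_vec_zero[OF carr(5)] by auto
  finally show ?thesis unfolding det_0_iff_vec_prod_zero[OF carr(5)] .
qed

text \<open>
  A real kernel vector of \<open>E - J + R\<close> is annihilated by the pencil for every value of its parameter. The
  reverse implication evaluates the determinant at the parameter \<open>1\<close>.
\<close>

lemma dissipative_regular_iff:
  assumes triple: "dissipative_triple n E J R"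
  shows "regular_pencil (complexify E) (complexify (J - R)) \<longleftrightarrow> det (E - J + R) \<noteq> 0"
proof
  note carr = dissipative_carriers[OF triple]
  assume "regular_pencil (complexify E) (complexify (J - R))"
  then obtain z where z: "det (z \<cdot>\<^sub>m complexify E - complexify (J - R)) \<noteq> 0" unfolding regular_pencil_def by blast
  show "det (E - J + R) \<noteq> 0"
  proof
    assume "det (E - J + R) = 0"
    then obtain v where v: "v \<in> carrier_vec n" "v \<noteq> 0\<^sub>v n" "(E - J + R) *\<^sub>v v = 0\<^sub>v n"
      using det_0_iff_vec_prod_zero[OF carr(5)] by blast
    then have kernel: "E *\<^sub>v v = 0\<^sub>v n" "(J - R) *\<^sub>v v = 0\<^sub>v n"
      using dissipative_kernel_iff[OF triple v(1)] dissipative_apply(1)[OF triple v(1)] by auto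
    define u where "u = map_vec complex_of_real v"
    have u: "u \<in> carrier_vec n" "u \<noteq> 0\<^sub>v n" using v by (auto simp: u_def of_real_hom.vec_hom_zero_iff)
    have "complexify E *\<^sub>v u = 0\<^sub>v n" "complexify (J - R) *\<^sub>v u = 0\<^sub>v n"
      using of_real_hom.mult_mat_vec_hom[OF carr(1) v(1), where 'a = complex]
        of_real_hom.mult_mat_vec_hom[OF carr(4) v(1), where 'a = complex] kernel
      by (simp_all add: u_def of_real_hom.vec_hom_zero)
    moreover have "(z \<cdot>\<^sub>m complexify E - complexify (J - R)) *\<^sub>v u =
        z \<cdot>\<^sub>v (complexify E *\<^sub>v u) - complexify (J - R) *\<^sub>v u"
      using minus_mult_distrib_mat_vec[of "z \<cdot>\<^sub>m complexify E" n n "complexify (J - R)" u]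
        smult_mat_mult_vec[of "complexify E" n n u z] carr u by simp
    ultimately have "(z \<cdot>\<^sub>m complexify E - complexify (J - R)) *\<^sub>v u = 0\<^sub>v n" by (simp, intro eq_vecI) auto
    moreover have "z \<cdot>\<^sub>m complexify E - complexify (J - R) \<in> carrier_mat n n" using carr by (auto intro!: minus_carrier_mat)
    ultimately show False using z u det_0_iff_vec_prod_zero by blast
  qed
next
  note carr = dissipative_carriers[OF triple]
  assume det: "det (E - J + R) \<noteq> 0"
  have "1 \<cdot>\<^sub>m complexify E - complexify (J - R) = complexify (E - J + R)"
    by (intro eq_matI) (use carr in auto)
  then have "det (1 \<cdot>\<^sub>m complexify E - complexify (J - R)) = complex_of_real (det (E - J + R))"
    by (simp only: of_real_hom.hom_det)
  then show "regular_pencil (complexify E) (complexify (J - R))"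
    using det unfolding regular_pencil_def by (metis of_real_eq_0_iff)
qed

lemma kernel_dim_zero_mat: "kernel.dim r (0\<^sub>m r r :: 'a::field mat) = r"
proof -
  have carr: "(0\<^sub>m r r :: 'a mat) \<in> carrier_mat r r" by simp
  have "pivot_fun (0\<^sub>m r r :: 'a mat) (\<lambda>_. r) r" by (rule pivot_funI) auto
  then have "row_echelon_form (0\<^sub>m r r :: 'a mat)" unfolding row_echelon_form_def by auto
  moreover have none: "{i. i < r \<and> row (0\<^sub>m r r :: 'a mat) i \<noteq> 0\<^sub>v r} = {}" by auto
  ultimately show ?thesis using find_base_vectors(6)[OF _ carr] unfolding none by simp
qed

lemma kernel_dim_invertible:
  fixes M :: "'a::field mat"
  assumes "M \<in> carrier_mat m m" "det M \<noteq> 0"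
  shows "kernel.dim m M = 0"
proof -
  obtain M' where M': "M' \<in> carrier_mat m m" "M * M' = 1\<^sub>m m" "M' * M = 1\<^sub>m m"
    using det_nonzero_inverse[OF assms] .
  have "mat_kernel M = mat_kernel (1\<^sub>m m)"
    using mat_kernel_mult_eq[OF assms(1) M'(1) assms(1) M'(2)] M'(3) by simp
  then show ?thesis using kernel_one_mat(1)[of m, where 'a = 'a] by simp
qed

lemma kernel_dim_deflated:
  assumes M: "M \<in> carrier_mat (m + r) (m + r)" and U: "real_orthogonal_mat (m + r) U"
    and M1: "M1 \<in> carrier_mat m m" "det M1 \<noteq> 0"
    and eq: "transpose_mat U * M * U = direct_sum_mat M1 (0\<^sub>m r r)"
  shows "kernel_dim M = r"
proof -
  let ?n = "m + r" and ?B = "direct_sum_mat M1 (0\<^sub>m r r)"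
  have Uc: "U \<in> carrier_mat ?n ?n" and UU: "transpose_mat U * U = 1\<^sub>m ?n"
    using U unfolding real_orthogonal_mat_def by auto
  have TU: "transpose_mat U \<in> carrier_mat ?n ?n" using Uc by simp
  have UU': "U * transpose_mat U = 1\<^sub>m ?n" by (rule mat_mult_left_right_inverse[OF TU Uc UU])
  have B: "?B \<in> carrier_mat ?n ?n" using M1 by (intro carrier_matI) auto
  have "M = U * ?B * transpose_mat U"
    unfolding eq[symmetric] by (rule mat_sandwich_cancel[symmetric, OF M TU Uc UU' Uc TU UU'])
  then have wit: "similar_mat_wit M ?B U (transpose_mat U)"
    by (intro similar_mat_witI[of _ _ ?n]) (use UU UU' M B Uc TU in auto)
  have "kernel_dim M = kernel.dim ?n M" unfolding kernel_dim_def using M by simp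
  also have "\<dots> = kernel.dim ?n ?B" by (rule similar_mat_wit_kernel_dim[OF M wit])
  also have "\<dots> = kernel.dim m M1 + kernel.dim r (0\<^sub>m r r :: real mat)"
    by (rule kernel_four_block_0_mat) (use M1 in auto)
  finally show ?thesis using kernel_dim_invertible[OF M1] kernel_dim_zero_mat by simp
qed

lemma complexify_congruence:
  assumes "X \<in> carrier_mat n n" "U \<in> carrier_mat n n"
  shows "complexify (transpose_mat U * X * U) = complexify (transpose_mat U) * complexify X * complexify U"
  using assms of_real_hom.mat_hom_mult[of "transpose_mat U * X" n n U n, where 'a = complex]
    of_real_hom.mat_hom_mult[of "transpose_mat U" n n X n, where 'a = complex] by simp

lemma dissipative_kronecker_form_exists:
  assumes triple: "dissipative_triple n E J R"
  shows "\<exists>K. kronecker_form (complexify E) (complexify (J - R)) K"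
proof -
  note carr = dissipative_carriers[OF triple]
  obtain m r U E1 J1 R1 where n: "n = m + r" and U: "real_orthogonal_mat n U"
    and triple1: "dissipative_triple m E1 J1 R1" and det: "det (E1 - J1 + R1) \<noteq> 0"
    and eqs: "transpose_mat U * E * U = direct_sum_mat E1 (0\<^sub>m r r)"
      "transpose_mat U * J * U = direct_sum_mat J1 (0\<^sub>m r r)" "transpose_mat U * R * U = direct_sum_mat R1 (0\<^sub>m r r)"
    using dissipative_deflation[OF triple] by blast
  note carr1 = dissipative_carriers[OF triple1]
  have Uc: "U \<in> carrier_mat n n" and UU: "transpose_mat U * U = 1\<^sub>m n" using U unfolding real_orthogonal_mat_def by auto
  have TU: "transpose_mat U \<in> carrier_mat n n" using Uc by simp
  have UU': "U * transpose_mat U = 1\<^sub>m n" by (rule mat_mult_left_right_inverse[OF TU Uc UU])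
  have eqA: "transpose_mat U * (J - R) * U = direct_sum_mat (J1 - R1) (0\<^sub>m r r)"
    unfolding congruence_add(2)[OF carr(2,3) Uc] eqs by (intro eq_matI) (use carr1 in auto)
  have ds: "complexify (direct_sum_mat X (0\<^sub>m r r)) = direct_sum_mat (complexify X) (0\<^sub>m r r)"
    if "X \<in> carrier_mat m m" for X
    by (intro eq_matI) (use that in auto)
  obtain K1 where K1: "kronecker_form (complexify E1) (complexify (J1 - R1)) K1"
    using kronecker_form_exists_if_regular[of "complexify E1" m "complexify (J1 - R1)"]
      map_carrier_mat carr1(1,4) dissipative_regular_iff[OF triple1] det by blast
  obtain K2 where K2: "kronecker_form (0\<^sub>m r r) (0\<^sub>m r r) K2" using kronecker_form_zero by blast
  have "kronecker_form (direct_sum_mat (complexify E1) (0\<^sub>m r r)) (direct_sum_mat (complexify (J1 - R1)) (0\<^sub>m r r)) (K1 @ K2)"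
    by (rule kronecker_form_direct_sum[OF K1 _ _ K2, of m m r r]) (use carr1 in auto)
  then have K: "kronecker_form (complexify (transpose_mat U * E * U)) (complexify (transpose_mat U * (J - R) * U)) (K1 @ K2)"
    unfolding eqs eqA ds[OF carr1(1)] ds[OF carr1(4)] .
  have inv: "complexify (transpose_mat U) * complexify U = 1\<^sub>m n" "complexify U * complexify (transpose_mat U) = 1\<^sub>m n"
    unfolding of_real_hom.mat_hom_mult[OF TU Uc, where 'a = complex, symmetric]
      of_real_hom.mat_hom_mult[OF Uc TU, where 'a = complex, symmetric] UU UU'
    by (rule of_real_hom.mat_hom_one)+
  have "strictly_equivalent (complexify E) (complexify (J - R))
      (complexify (transpose_mat U * E * U)) (complexify (transpose_mat U * (J - R) * U))"
    by (rule strictly_equivalentI[OF _ _ _ inv(1,2) _ _ inv(2,1) complexify_congruence[OF carr(1) Uc] complexify_congruence[OF carr(4) Uc]])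
      (use carr Uc TU in simp_all)
  then show ?thesis
    by (rule kronecker_form_exists_strictly_equivalent[of _ _ _ _ n n])
      (use K map_carrier_mat carr(1,4) in blast)+
qed

lemma dissipative_no_long_complex_chain:
  assumes triple: "dissipative_triple n E J R"
  shows "\<not> infinity_chain (complexify E) (complexify (J - R)) 2"
    "\<not> infinity_chain (transpose_mat (complexify E)) (transpose_mat (complexify (J - R))) 2"
proof -
  note carr = dissipative_carriers[OF triple] and T = dissipative_transpose[OF triple]
  note carr' = dissipative_carriers[OF T(3)]
  show "\<not> infinity_chain (complexify E) (complexify (J - R)) 2"
    unfolding infinity_chain_complexify_iff[OF carr(1,4)] by (rule dissipative_no_long_chain[OF triple])
  have tr: "transpose_mat (complexify X) = complexify (transpose_mat X)" for X :: "real mat"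
    by (intro eq_matI) auto
  show "\<not> infinity_chain (transpose_mat (complexify E)) (transpose_mat (complexify (J - R))) 2"
    unfolding tr T(1,2) infinity_chain_complexify_iff[OF carr'(1,4)] by (rule dissipative_no_long_chain[OF T(3)])
qed

lemma dissipative_infinity_chain_iff:
  assumes triple: "dissipative_triple n E J R"
  shows "infinity_chain E (J - R) k \<longleftrightarrow> k < pencil_index (complexify E) (complexify (J - R))"
proof -
  note carr = dissipative_carriers[OF triple]
  obtain K where "kronecker_form (complexify E) (complexify (J - R)) K"
    using dissipative_kronecker_form_exists[OF triple] by blast
  from infinity_chain_iff_less_pencil_index[OF this _ _ dissipative_no_long_complex_chain(1)[OF triple], of n n k]
  show ?thesis unfolding infinity_chain_complexify_iff[OF carr(1,4)] using carr by simp
qed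

lemma dissipative_pencil_index_le_2:
  assumes "dissipative_triple n E J R"
  shows "pencil_index (complexify E) (complexify (J - R)) \<le> 2"
  using dissipative_infinity_chain_iff[OF assms, of 2] dissipative_no_long_chain[OF assms] by simp

section \<open>Approximation by pencils of index two\<close>

text \<open>
  If \<open>M' v = 0\<close> and \<open>N\<close> is the inverse of \<open>M\<close>, then \<open>v = N (M - M') v\<close>; this bounds the largest entry of
  \<open>v\<close> by a multiple of itself with a factor below one.
\<close>

lemma invertible_perturbation:
  fixes M :: "real mat"
  assumes M: "M \<in> carrier_mat n n" and det: "det M \<noteq> 0"
  obtains \<delta> where "0 < \<delta>"
    "\<And>M'. M' \<in> carrier_mat n n \<Longrightarrow> (\<And>i j. i < n \<Longrightarrow> j < n \<Longrightarrow> \<bar>M $$ (i, j) - M' $$ (i, j)\<bar> \<le> \<delta>) \<Longrightarrow> det M' \<noteq> 0"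
proof -
  obtain N where N: "N \<in> carrier_mat n n" "N * M = 1\<^sub>m n"
    using det_nonzero_inverse[OF M det] by metis
  \<comment> \<open>With V the largest absolute value of an entry of v, \<open>M - M'\<close> and N enlarge V at
     most by the factors \<open>n \<delta>\<close> and S; the summand 1 in the denominator of
     \<open>\<delta>\<close> makes the product less than one.\<close>
  define S where "S = (\<Sum>i = 0..<n. \<Sum>j = 0..<n. \<bar>N $$ (i, j)\<bar>)"
  have S: "0 \<le> S" unfolding S_def by (intro sum_nonneg) simp
  define \<delta> where "\<delta> = 1 / (real n * S + 1)"
  have nS: "0 \<le> real n * S" using S by simp
  then have pos: "0 < \<delta>" and small: "S * (real n * \<delta>) < 1" by (simp_all add: \<delta>_def field_simps)
  have "det M' \<noteq> 0" if M': "M' \<in> carrier_mat n n"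
    and close: "\<And>i j. i < n \<Longrightarrow> j < n \<Longrightarrow> \<bar>M $$ (i, j) - M' $$ (i, j)\<bar> \<le> \<delta>" for M'
  proof
    assume "det M' = 0"
    then obtain v where v: "v \<in> carrier_vec n" "v \<noteq> 0\<^sub>v n" "M' *\<^sub>v v = 0\<^sub>v n"
      using det_0_iff_vec_prod_zero[OF M'] by blast
    have "n \<noteq> 0" using v(1,2) by (auto intro!: eq_vecI)
    define V where "V = Max ((\<lambda>i. \<bar>v $ i\<bar>) ` {0..<n})"
    have le_V: "\<bar>v $ i\<bar> \<le> V" if "i < n" for i unfolding V_def using that by (intro Max_ge) auto
    have "V \<in> (\<lambda>i. \<bar>v $ i\<bar>) ` {0..<n}" unfolding V_def using \<open>n \<noteq> 0\<close> by (intro Max_in) auto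
    then obtain m where m: "m < n" "\<bar>v $ m\<bar> = V" by auto
    have "V \<noteq> 0"
    proof
      assume "V = 0"
      then have "v = 0\<^sub>v n" using le_V v(1) by (intro eq_vecI) fastforce+
      with v show False by simp
    qed
    then have V: "0 < V" using m by fastforce
    define u where "u = M *\<^sub>v v"
    have u: "u \<in> carrier_vec n" using M v by (simp add: u_def)
    have u_small: "\<bar>u $ i\<bar> \<le> real n * \<delta> * V" if i: "i < n" for i
    proof -
      have "(M' *\<^sub>v v) $ i = 0" using i by (simp only: v(3) index_zero_vec)
      then have "u $ i = (M *\<^sub>v v) $ i - (M' *\<^sub>v v) $ i" by (simp add: u_def)
      also have "\<dots> = (\<Sum>j = 0..<n. M $$ (i, j) * v $ j) - (\<Sum>j = 0..<n. M' $$ (i, j) * v $ j)"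
        using i M M' v(1) by (simp add: scalar_prod_def)
      also have "\<dots> = (\<Sum>j = 0..<n. (M $$ (i, j) - M' $$ (i, j)) * v $ j)"
        by (simp add: sum_subtractf left_diff_distrib)
      finally have "\<bar>u $ i\<bar> \<le> (\<Sum>j = 0..<n. \<bar>(M $$ (i, j) - M' $$ (i, j)) * v $ j\<bar>)" by (metis sum_abs)
      also have "\<dots> \<le> (\<Sum>j = 0..<n. \<delta> * V)"
        unfolding abs_mult using close[OF i] le_V pos by (intro sum_mono mult_mono) auto
      finally show ?thesis by simp
    qed
    have "v = N *\<^sub>v u"
      using assoc_mult_mat_vec[OF N(1) M v(1)] N(2) v(1) by (simp add: u_def)
    then have "V = \<bar>(N *\<^sub>v u) $ m\<bar>" using m by simp
    also have "(N *\<^sub>v u) $ m = (\<Sum>j = 0..<n. N $$ (m, j) * u $ j)"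
      using m N u by (simp add: scalar_prod_def)
    also have "\<bar>\<dots>\<bar> \<le> (\<Sum>j = 0..<n. \<bar>N $$ (m, j) * u $ j\<bar>)" by (rule sum_abs)
    also have "\<dots> \<le> (\<Sum>j = 0..<n. \<bar>N $$ (m, j)\<bar> * (real n * \<delta> * V))"
      unfolding abs_mult using u_small by (intro sum_mono mult_left_mono) auto
    also have "\<dots> = (\<Sum>j = 0..<n. \<bar>N $$ (m, j)\<bar>) * (real n * \<delta> * V)" by (simp add: sum_distrib_right)
    also have "\<dots> \<le> S * (real n * \<delta> * V)"
    proof (rule mult_right_mono)
      show "(\<Sum>j = 0..<n. \<bar>N $$ (m, j)\<bar>) \<le> S"
        unfolding S_def using m by (intro member_le_sum[of m "{0..<n}" "\<lambda>i. \<Sum>j = 0..<n. \<bar>N $$ (i, j)\<bar>"]) (auto intro: sum_nonneg)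
    qed (use pos V in simp)
    also have "\<dots> = S * (real n * \<delta>) * V" by simp
    also have "\<dots> < 1 * V" using small V by (rule mult_strict_right_mono)
    finally show False by simp
  qed
  with pos show thesis using that by blast
qed

lemma frobenius_norm_entry_le:
  assumes "i < dim_row A" "j < dim_col A"
  shows "\<bar>A $$ (i, j)\<bar> \<le> frobenius_norm A"
proof -
  have "(A $$ (i, j))\<^sup>2 \<le> (\<Sum>j<dim_col A. (A $$ (i, j))\<^sup>2)"
    using assms by (intro member_le_sum[of j _ "\<lambda>j. (A $$ (i, j))\<^sup>2"]) auto
  also have "\<dots> \<le> (\<Sum>i<dim_row A. \<Sum>j<dim_col A. (A $$ (i, j))\<^sup>2)"
    using assms by (intro member_le_sum[of i _ "\<lambda>i. \<Sum>j<dim_col A. (A $$ (i, j))\<^sup>2"]) (auto intro: sum_nonneg)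
  finally show ?thesis unfolding frobenius_norm_def by (metis real_sqrt_abs real_sqrt_le_mono)
qed

lemma frobenius_norm_smult: "frobenius_norm (a \<cdot>\<^sub>m A) = \<bar>a\<bar> * frobenius_norm A"
proof -
  have "(\<Sum>i<dim_row (a \<cdot>\<^sub>m A). \<Sum>j<dim_col (a \<cdot>\<^sub>m A). ((a \<cdot>\<^sub>m A) $$ (i, j))\<^sup>2) =
      a\<^sup>2 * (\<Sum>i<dim_row A. \<Sum>j<dim_col A. (A $$ (i, j))\<^sup>2)"
    by (simp add: sum_distrib_left power_mult_distrib)
  then show ?thesis unfolding frobenius_norm_def by (simp add: real_sqrt_mult)
qed

lemma append_cols_dim: "dim_row (append_cols A B) = dim_row A" "dim_col (append_cols A B) = dim_col A + dim_col B"
  unfolding append_cols_def by simp_all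

lemma append_cols_index:
  assumes "i < dim_row A"
  shows "j < dim_col A \<Longrightarrow> append_cols A B $$ (i, j) = A $$ (i, j)"
    "j < dim_col B \<Longrightarrow> append_cols A B $$ (i, dim_col A + j) = B $$ (i, j)"
  using assms unfolding append_cols_def by simp_all

lemma append_cols_smult:
  assumes "A \<in> carrier_mat n m" "B \<in> carrier_mat n k"
  shows "append_cols (a \<cdot>\<^sub>m A) (a \<cdot>\<^sub>m B) = a \<cdot>\<^sub>m append_cols A B"
  by (intro eq_matI) (use assms in \<open>auto simp: append_cols_def\<close>)

lemma sum_lessThan_add:
  fixes f :: "nat \<Rightarrow> 'a::comm_monoid_add"
  shows "(\<Sum>j<a + b. f j) = (\<Sum>j<a. f j) + (\<Sum>j<b. f (a + j))"
  by (induction b) (simp_all add: add.assoc)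

lemma frobenius_norm_append_zero:
  assumes B: "B \<in> carrier_mat n m"
  shows "frobenius_norm (append_cols B (0\<^sub>m n k)) = frobenius_norm B"
proof -
  have "(\<Sum>j<m + k. (append_cols B (0\<^sub>m n k) $$ (i, j))\<^sup>2) = (\<Sum>j<m. (B $$ (i, j))\<^sup>2)" if "i < n" for i
    unfolding sum_lessThan_add
    using B that append_cols_index[of i B _ "0\<^sub>m n k"] by auto
  then show ?thesis unfolding frobenius_norm_def append_cols_dim using B by simp
qed

lemma append_cols_append_zero:
  assumes "A \<in> carrier_mat n l" "B \<in> carrier_mat n m"
  shows "append_cols A (append_cols B (0\<^sub>m n k)) = append_cols (append_cols A B) (0\<^sub>m n k)"
  by (intro eq_matI) (use assms in \<open>auto simp: append_cols_def\<close>)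

text \<open>
  The case \<open>J = 0\<close> of the description of the kernel of \<open>E - J + R\<close>.
\<close>

lemma common_kernel_iff:
  assumes E: "psd_mat n E" and R: "psd_mat n R"
  shows "mat_kernel E \<inter> mat_kernel R \<noteq> {0\<^sub>v n} \<longleftrightarrow> det (E + R) = 0"
proof -
  have carr: "E \<in> carrier_mat n n" "R \<in> carrier_mat n n" using E R unfolding psd_mat_def by auto
  have triple: "dissipative_triple n E (0\<^sub>m n n) R"
    using E R unfolding dissipative_triple_def skew_mat_def by auto
  have "mat_kernel (0\<^sub>m n n) \<inter> mat_kernel E \<inter> mat_kernel R = mat_kernel E \<inter> mat_kernel R"
    using carr unfolding mat_kernel_def by (auto intro!: eq_vecI)
  moreover have "E - 0\<^sub>m n n + R = E + R" by (intro eq_matI) (use carr in auto)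
  ultimately show ?thesis using dissipative_common_kernel_iff[OF triple] by simp
qed

text \<open>
  Index two provides a chain of two vectors, whose first vector lies in both kernels.
\<close>

lemma index_two_imp_common_kernel:
  assumes triple: "dissipative_triple n E J R" and index: "pencil_index (complexify E) (complexify (J - R)) = 2"
  shows "det (E + R) = 0"
proof -
  note carr = dissipative_carriers[OF triple]
  have "infinity_chain E (J - R) 1" unfolding dissipative_infinity_chain_iff[OF triple] index by simp
  then obtain x where x: "\<And>i. i \<le> 1 \<Longrightarrow> x i \<in> carrier_vec n"
    and x0: "E *\<^sub>v x 0 = 0\<^sub>v n" and xs: "\<And>i. i < 1 \<Longrightarrow> E *\<^sub>v x (Suc i) = (J - R) *\<^sub>v x i"
    and nz: "(J - R) *\<^sub>v x 0 \<noteq> 0\<^sub>v n"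
    using carr unfolding infinity_chain_def by auto
  have "R *\<^sub>v x 0 = 0\<^sub>v n"
    using dissipative_chain_start[OF triple x[of 0] x[of 1] x0] xs[of 0] by simp
  then have "(E + R) *\<^sub>v x 0 = 0\<^sub>v n" using add_mult_distrib_mat_vec[OF carr(1,3) x[of 0]] x0 by simp
  moreover have "x 0 \<noteq> 0\<^sub>v n" using nz mult_mat_vec_zero[OF carr(4)] by auto
  moreover have "E + R \<in> carrier_mat n n" using carr by simp
  ultimately show ?thesis using det_0_iff_vec_prod_zero x[of 0] by blast
qed

lemma common_kernel_if_in_closure:
  assumes E: "psd_mat n E" and R: "psd_mat n R" and J: "skew_mat n J" and cl: "in_closure_of_index_two n E J R"
  shows "mat_kernel E \<inter> mat_kernel R \<noteq> {0\<^sub>v n}"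
proof (rule ccontr)
  assume "\<not> mat_kernel E \<inter> mat_kernel R \<noteq> {0\<^sub>v n}"
  then have det: "det (E + R) \<noteq> 0" using common_kernel_iff[OF E R] by blast
  have carr: "E \<in> carrier_mat n n" "R \<in> carrier_mat n n" "J \<in> carrier_mat n n"
    using E R J unfolding psd_mat_def skew_mat_def by auto
  have ER: "E + R \<in> carrier_mat n n" using carr by simp
  obtain \<delta> where \<delta>: "0 < \<delta>" and open_det: "\<And>M'. M' \<in> carrier_mat n n \<Longrightarrow>
      (\<And>i j. i < n \<Longrightarrow> j < n \<Longrightarrow> \<bar>(E + R) $$ (i, j) - M' $$ (i, j)\<bar> \<le> \<delta>) \<Longrightarrow> det M' \<noteq> 0"
    using invertible_perturbation[OF ER det] by metis
  obtain E' J' R' where psd': "psd_mat n E'" "psd_mat n R'" "skew_mat n J'"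
    and index: "pencil_index (complexify E') (complexify (J' - R')) = 2"
    and le: "frobenius_norm (append_cols (E - E') (append_cols (J - J') (R - R'))) \<le> \<delta> / 2"
  proof -
    have "0 < \<delta> / 2" using \<delta> by simp
    with cl show thesis using that unfolding in_closure_of_index_two_def by metis
  qed
  have carr': "E' \<in> carrier_mat n n" "R' \<in> carrier_mat n n" "J' \<in> carrier_mat n n"
    using psd' unfolding psd_mat_def skew_mat_def by auto
  have "det (E' + R') = 0"
    using index_two_imp_common_kernel[OF _ index] psd' unfolding dissipative_triple_def by blast
  moreover have "det (E' + R') \<noteq> 0"
  proof (rule open_det)
    fix i j assume ij: "i < n" "j < n"
    define X where "X = append_cols (E - E') (append_cols (J - J') (R - R'))"
    have "X $$ (i, j) = E $$ (i, j) - E' $$ (i, j)"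
      using ij carr carr' unfolding X_def by (subst append_cols_index(1)) auto
    moreover have "\<bar>X $$ (i, j)\<bar> \<le> frobenius_norm X"
      by (rule frobenius_norm_entry_le) (use ij carr' in \<open>auto simp: X_def append_cols_dim\<close>)
    ultimately have 1: "\<bar>E $$ (i, j) - E' $$ (i, j)\<bar> \<le> \<delta> / 2" using le by (simp add: X_def)
    have "X $$ (i, dim_col (E - E') + (dim_col (J - J') + j)) = R $$ (i, j) - R' $$ (i, j)"
      using ij carr carr' unfolding X_def
      by (subst append_cols_index(2), simp, simp add: append_cols_dim, subst append_cols_index(2)) auto
    moreover have "\<bar>X $$ (i, dim_col (E - E') + (dim_col (J - J') + j))\<bar> \<le> frobenius_norm X"
      by (rule frobenius_norm_entry_le) (use ij carr' in \<open>auto simp: X_def append_cols_dim\<close>)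
    ultimately have 2: "\<bar>R $$ (i, j) - R' $$ (i, j)\<bar> \<le> \<delta> / 2" using le by (simp add: X_def)
    show "\<bar>(E + R) $$ (i, j) - (E' + R') $$ (i, j)\<bar> \<le> \<delta>"
      using 1 2 ij carr carr' abs_triangle_ineq[of "E $$ (i, j) - E' $$ (i, j)" "R $$ (i, j) - R' $$ (i, j)"]
      by (simp add: algebra_simps)
  qed (use carr' in simp)
  ultimately show False by blast
qed

text \<open>
  A kernel vector of \<open>E - J + R\<close> is a multiple of \<open>v\<close> annihilated by \<open>J\<close>, hence zero, and the pencil is
  regular. For the index, a second chain vector \<open>y\<close> with \<open>E y = J v\<close> is needed. As \<open>E + v v\<^sup>T\<close> is positive
  definite, \<open>(E + v v\<^sup>T) y = J v\<close> has a solution, and \<open>v \<bullet> J v = 0\<close> forces \<open>v \<bullet> y = 0\<close>.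
\<close>

lemma index_two_perturbation:
  fixes v :: "real vec"
  assumes triple: "dissipative_triple n E J R" and v: "v \<in> carrier_vec n"
    and kernel: "\<And>x. x \<in> carrier_vec n \<Longrightarrow> E *\<^sub>v x = 0\<^sub>v n \<longleftrightarrow> (\<exists>a. x = a \<cdot>\<^sub>v v)"
    and Rv: "R *\<^sub>v v = 0\<^sub>v n" and Jv: "J *\<^sub>v v \<noteq> 0\<^sub>v n"
  shows "regular_pencil (complexify E) (complexify (J - R))"
    "pencil_index (complexify E) (complexify (J - R)) = 2"
proof -
  note carr = dissipative_carriers[OF triple]
  have sym: "transpose_mat E = E" and psd: "psd_mat n E" and skew: "skew_mat n J"
    using triple unfolding dissipative_triple_def psd_mat_def by auto
  have JJ: "J *\<^sub>v 0\<^sub>v n = 0\<^sub>v n" by (rule mult_mat_vec_zero[OF carr(2)])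
  have "v \<noteq> 0\<^sub>v n" using Jv JJ by auto
  then have vv: "v \<bullet> v \<noteq> 0" using real_scalar_prod_self_eq_0[OF _ v] by blast
  have Ev: "E *\<^sub>v v = 0\<^sub>v n" using kernel[OF v] by (metis one_smult_vec)
  have "det (E - J + R) \<noteq> 0"
  proof
    assume "det (E - J + R) = 0"
    then obtain x where x: "x \<in> carrier_vec n" "x \<noteq> 0\<^sub>v n" "(E - J + R) *\<^sub>v x = 0\<^sub>v n"
      using det_0_iff_vec_prod_zero[OF carr(5)] by blast
    then have Ex: "E *\<^sub>v x = 0\<^sub>v n" and Jx: "J *\<^sub>v x = 0\<^sub>v n" using dissipative_kernel_iff[OF triple x(1)] by auto
    obtain a where a: "x = a \<cdot>\<^sub>v v" using kernel[OF x(1)] Ex by blast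
    have "a \<noteq> 0"
    proof
      assume "a = 0"
      then have "x = 0\<^sub>v n" using v unfolding a by (intro eq_vecI) auto
      with x(2) show False ..
    qed
    moreover have "a \<cdot>\<^sub>v (J *\<^sub>v v) = 0\<^sub>v n" using Jx mult_mat_vec[OF carr(2) v] unfolding a by simp
    then have "(1 / a) \<cdot>\<^sub>v (a \<cdot>\<^sub>v (J *\<^sub>v v)) = (1 / a) \<cdot>\<^sub>v 0\<^sub>v n" by simp
    then have "(1 / a * a) \<cdot>\<^sub>v (J *\<^sub>v v) = 0\<^sub>v n" unfolding smult_smult_assoc by (simp, intro eq_vecI) auto
    ultimately show False using Jv by simp
  qed
  then show "regular_pencil (complexify E) (complexify (J - R))"
    using dissipative_regular_iff[OF triple] by blast
  define P where "P = mat n n (\<lambda>(i, j). v $ i * v $ j)"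
  have P: "P \<in> carrier_mat n n" by (simp add: P_def)
  have Px: "P *\<^sub>v x = (v \<bullet> x) \<cdot>\<^sub>v v" if "x \<in> carrier_vec n" for x
    using that v by (intro eq_vecI) (auto simp: P_def scalar_prod_def sum_distrib_right sum_distrib_left intro!: sum.cong)
  have EP: "E + P \<in> carrier_mat n n" using P by simp
  have EPx: "(E + P) *\<^sub>v x = E *\<^sub>v x + (v \<bullet> x) \<cdot>\<^sub>v v" if "x \<in> carrier_vec n" for x
    using add_mult_distrib_mat_vec[OF carr(1) P that] Px[OF that] by simp
  have "det (E + P) \<noteq> 0"
  proof
    assume "det (E + P) = 0"
    then obtain x where x: "x \<in> carrier_vec n" "x \<noteq> 0\<^sub>v n" "(E + P) *\<^sub>v x = 0\<^sub>v n"
      using det_0_iff_vec_prod_zero[OF EP] by blast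
    have "x \<bullet> (E *\<^sub>v x + (v \<bullet> x) \<cdot>\<^sub>v v) = 0" using x EPx by simp
    then have "x \<bullet> (E *\<^sub>v x) + (v \<bullet> x) * (v \<bullet> x) = 0"
      using x v carr comm_scalar_prod[OF x(1) v] by (simp add: scalar_prod_add_distrib[of _ n])
    moreover have "0 \<le> x \<bullet> (E *\<^sub>v x)" using psd x unfolding psd_mat_def by blast
    moreover have "0 \<le> (v \<bullet> x) * (v \<bullet> x)" by simp
    ultimately have "x \<bullet> (E *\<^sub>v x) = 0" and "(v \<bullet> x) * (v \<bullet> x) = 0" by linarith+
    then have vx: "v \<bullet> x = 0" and "E *\<^sub>v x = 0\<^sub>v n" using psd_scalar_prod_eq_0[OF psd x(1)] by auto
    then obtain a where a: "x = a \<cdot>\<^sub>v v" using kernel[OF x(1)] by blast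
    then have "a = 0" using vx vv v by simp
    then have "x = 0\<^sub>v n" using v unfolding a by (intro eq_vecI) auto
    with x(2) show False ..
  qed
  then obtain N where N: "N \<in> carrier_mat n n" "(E + P) * N = 1\<^sub>m n"
    using det_nonzero_inverse[OF EP] by metis
  define y where "y = N *\<^sub>v (J *\<^sub>v v)"
  have Jv': "J *\<^sub>v v \<in> carrier_vec n" using carr v by simp
  have y: "y \<in> carrier_vec n" using N Jv' by (simp add: y_def)
  have "(E + P) *\<^sub>v y = J *\<^sub>v v"
    using assoc_mult_mat_vec[OF EP N(1) Jv'] N(2) Jv' by (simp add: y_def)
  then have sol: "E *\<^sub>v y + (v \<bullet> y) \<cdot>\<^sub>v v = J *\<^sub>v v" unfolding EPx[OF y] .
  have "v \<bullet> (E *\<^sub>v y + (v \<bullet> y) \<cdot>\<^sub>v v) = y \<bullet> (E *\<^sub>v v) + (v \<bullet> y) * (v \<bullet> v)"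
    using symmetric_scalar_prod[OF carr(1) sym v y] v y carr by (simp add: scalar_prod_add_distrib[of _ n])
  then have "(v \<bullet> y) * (v \<bullet> v) = 0" unfolding sol skew_scalar_prod_self[OF skew v] Ev using y by simp
  then have "v \<bullet> y = 0" using vv by simp
  then have "E *\<^sub>v y + 0 \<cdot>\<^sub>v v = J *\<^sub>v v" using sol by simp
  moreover have "0 \<cdot>\<^sub>v v = 0\<^sub>v n" using v by (intro eq_vecI) auto
  ultimately have Ey: "E *\<^sub>v y = J *\<^sub>v v" using carr(1) y by simp
  have A: "(J - R) *\<^sub>v v = J *\<^sub>v v" unfolding dissipative_apply(1)[OF triple v] Rv using Jv' by simp
  have "infinity_chain E (J - R) 1"
    unfolding infinity_chain_def
  proof (rule exI[of _ "\<lambda>i. if i = 0 then v else y"], intro conjI allI impI)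
    show "(J - R) *\<^sub>v (if (0::nat) = 0 then v else y) \<noteq> 0\<^sub>v (dim_row (J - R))" using A Jv carr by auto
  qed (use v y Ev Ey A carr in auto)
  then have "1 < pencil_index (complexify E) (complexify (J - R))"
    unfolding dissipative_infinity_chain_iff[OF triple] .
  then show "pencil_index (complexify E) (complexify (J - R)) = 2"
    using dissipative_pencil_index_le_2[OF triple] by simp
qed

text \<open>
  The matrix \<open>(v \<bullet> v) I - v v\<^sup>T\<close>; its positivity is the Cauchy-Schwarz inequality.
\<close>

lemma scaled_orthogonal_projection:
  fixes v :: "real vec"
  assumes v: "v \<in> carrier_vec n" "v \<noteq> 0\<^sub>v n"
  obtains X where "psd_mat n X" "\<And>x. x \<in> carrier_vec n \<Longrightarrow> X *\<^sub>v x = 0\<^sub>v n \<longleftrightarrow> (\<exists>a. x = a \<cdot>\<^sub>v v)"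
proof
  define X where "X = mat n n (\<lambda>(i, j). (if i = j then v \<bullet> v else 0) - v $ i * v $ j)"
  have X: "X \<in> carrier_mat n n" by (simp add: X_def)
  have vv: "0 < v \<bullet> v" using real_scalar_prod_self_ge_0[of v] real_scalar_prod_self_eq_0[OF _ v(1)] v(2) by fastforce
  have Xx: "X *\<^sub>v x = (v \<bullet> v) \<cdot>\<^sub>v x - (v \<bullet> x) \<cdot>\<^sub>v v" if x: "x \<in> carrier_vec n" for x
  proof (rule eq_vecI)
    fix i assume "i < dim_vec ((v \<bullet> v) \<cdot>\<^sub>v x - (v \<bullet> x) \<cdot>\<^sub>v v)"
    then have i: "i < n" using v by simp
    have "(X *\<^sub>v x) $ i = (\<Sum>j = 0..<n. X $$ (i, j) * x $ j)" using i X x by (simp add: scalar_prod_def)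
    also have "\<dots> = (\<Sum>j = 0..<n. (if j = i then (v \<bullet> v) * x $ j else 0) - v $ i * (v $ j * x $ j))"
      using i by (intro sum.cong) (auto simp: X_def algebra_simps)
    also have "\<dots> = (v \<bullet> v) * x $ i - v $ i * (v \<bullet> x)"
      using i x by (simp add: sum_subtractf sum_distrib_left[symmetric] scalar_prod_def[of v x])
    finally show "(X *\<^sub>v x) $ i = ((v \<bullet> v) \<cdot>\<^sub>v x - (v \<bullet> x) \<cdot>\<^sub>v v) $ i" using i x v by simp
  qed (use X v in simp)
  have "0 \<le> x \<bullet> (X *\<^sub>v x)" if x: "x \<in> carrier_vec n" for x
  proof -
    define y where "y = (v \<bullet> v) \<cdot>\<^sub>v x - (v \<bullet> x) \<cdot>\<^sub>v v"
    have y: "y \<in> carrier_vec n" using x v by (simp add: y_def)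
    have xv: "x \<bullet> v = v \<bullet> x" using x v by (simp add: comm_scalar_prod[of _ n])
    have split: "z \<bullet> y = (v \<bullet> v) * (z \<bullet> x) - (v \<bullet> x) * (z \<bullet> v)" if "z \<in> carrier_vec n" for z
      using that x v unfolding y_def by (simp add: scalar_prod_minus_distrib[of _ n])
    have "v \<bullet> y = 0" unfolding split[OF v(1)] by simp
    then have yv: "y \<bullet> v = 0" using y v by (simp add: comm_scalar_prod[of _ n])
    have "y \<bullet> y = (v \<bullet> v) * (y \<bullet> x)" unfolding split[OF y] yv by simp
    then have "0 \<le> (v \<bullet> v) * (y \<bullet> x)" using real_scalar_prod_self_ge_0[of y] by simp
    then have "0 \<le> y \<bullet> x" using vv by (simp add: zero_le_mult_iff)
    then show ?thesis unfolding Xx[OF x] y_def[symmetric] using x y by (simp add: comm_scalar_prod[of x n y])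
  qed
  moreover have "transpose_mat X = X" by (intro eq_matI) (auto simp: X_def)
  ultimately show "psd_mat n X" using X unfolding psd_mat_def by blast
  show "X *\<^sub>v x = 0\<^sub>v n \<longleftrightarrow> (\<exists>a. x = a \<cdot>\<^sub>v v)" if x: "x \<in> carrier_vec n" for x
  proof
    assume "X *\<^sub>v x = 0\<^sub>v n"
    then have zero: "(v \<bullet> v) \<cdot>\<^sub>v x - (v \<bullet> x) \<cdot>\<^sub>v v = 0\<^sub>v n" unfolding Xx[OF x] .
    have "x = ((v \<bullet> x) / (v \<bullet> v)) \<cdot>\<^sub>v v"
    proof (rule eq_vecI)
      fix i assume "i < dim_vec (((v \<bullet> x) / (v \<bullet> v)) \<cdot>\<^sub>v v)"
      then have i: "i < n" using v by simp
      have "(v \<bullet> v) * x $ i - (v \<bullet> x) * v $ i = 0"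
        using arg_cong[OF zero, of "\<lambda>z. z $ i"] i x v by simp
      then show "x $ i = (((v \<bullet> x) / (v \<bullet> v)) \<cdot>\<^sub>v v) $ i" using vv i v by (simp add: field_simps)
    qed (use x v in simp)
    then show "\<exists>a. x = a \<cdot>\<^sub>v v" ..
  next
    assume "\<exists>a. x = a \<cdot>\<^sub>v v"
    then obtain a where a: "x = a \<cdot>\<^sub>v v" ..
    show "X *\<^sub>v x = 0\<^sub>v n" unfolding Xx[OF x] unfolding a using v by (intro eq_vecI) auto
  qed
qed

text \<open>
  An elementary skew-symmetric matrix that moves a nonzero coordinate of \<open>v\<close> to another position.
\<close>

lemma skew_not_annihilating:
  fixes v :: "real vec"
  assumes v: "v \<in> carrier_vec n" "v \<noteq> 0\<^sub>v n" and n: "n \<noteq> 1"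
  obtains Y where "skew_mat n Y" "Y *\<^sub>v v \<noteq> 0\<^sub>v n"
proof -
  obtain k where k: "k < n" "v $ k \<noteq> 0" using v by (metis eq_vecI carrier_vecD index_zero_vec)
  define j where "j = (if k = 0 then 1 else 0 :: nat)"
  have j: "j < n" "j \<noteq> k" using k n by (auto simp: j_def)
  define Y :: "real mat" where "Y = mat n n (\<lambda>(a, b). if a = j \<and> b = k then 1 else if a = k \<and> b = j then - 1 else 0)"
  have Y: "Y \<in> carrier_mat n n" by (simp add: Y_def)
  have "(Y *\<^sub>v v) $ j = (\<Sum>b = 0..<n. Y $$ (j, b) * v $ b)" using j Y v by (simp add: scalar_prod_def)
  also have "\<dots> = (\<Sum>b = 0..<n. if b = k then v $ b else 0)" using j by (intro sum.cong) (auto simp: Y_def)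
  also have "\<dots> = v $ k" using k by simp
  finally have "(Y *\<^sub>v v) $ j \<noteq> 0\<^sub>v n $ j" using k j by simp
  then have "Y *\<^sub>v v \<noteq> 0\<^sub>v n" by metis
  moreover have "skew_mat n Y" unfolding skew_mat_def using j by (auto simp: Y_def intro!: eq_matI)
  ultimately show thesis using that by blast
qed

text \<open>
  A multiple of \<open>(v \<bullet> v) I - v v\<^sup>T\<close> added to \<open>E\<close> makes \<open>v\<close> span its kernel, and a skew-symmetric matrix
  added to \<open>J\<close> ensures \<open>J v \<noteq> 0\<close>. As \<open>R\<close> is kept, the two block matrices whose norms measure the distance
  differ only by zero columns.
\<close>

lemma in_closure_if_common_kernel:
  assumes E: "psd_mat n E" and R: "psd_mat n R" and J: "skew_mat n J" and n: "n \<noteq> 1"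
    and ker: "mat_kernel E \<inter> mat_kernel R \<noteq> {0\<^sub>v n}"
  shows "in_closure_of_index_two n E J R"
proof -
  have carr: "E \<in> carrier_mat n n" "R \<in> carrier_mat n n" "J \<in> carrier_mat n n"
    using E R J unfolding psd_mat_def skew_mat_def by auto
  have "0\<^sub>v n \<in> mat_kernel E \<inter> mat_kernel R"
    using carr mult_mat_vec_zero[OF carr(1)] mult_mat_vec_zero[OF carr(2)] by (auto simp: mat_kernel_def)
  then obtain v where "v \<in> mat_kernel E" "v \<in> mat_kernel R" and v0: "v \<noteq> 0\<^sub>v n" using ker by blast
  then have v: "v \<in> carrier_vec n" and Ev: "E *\<^sub>v v = 0\<^sub>v n" and Rv: "R *\<^sub>v v = 0\<^sub>v n"
    using mat_kernelD[OF carr(1)] mat_kernelD[OF carr(2)] by blast+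
  obtain X where X: "psd_mat n X" "\<And>x. x \<in> carrier_vec n \<Longrightarrow> X *\<^sub>v x = 0\<^sub>v n \<longleftrightarrow> (\<exists>a. x = a \<cdot>\<^sub>v v)"
    using scaled_orthogonal_projection[OF v v0] by metis
  have Xc: "X \<in> carrier_mat n n" using X unfolding psd_mat_def by blast
  obtain Y where Y: "skew_mat n Y" "\<And>\<delta>. 0 < \<delta> \<Longrightarrow> (J + \<delta> \<cdot>\<^sub>m Y) *\<^sub>v v \<noteq> 0\<^sub>v n"
  proof (cases "J *\<^sub>v v = 0\<^sub>v n")
    case True
    obtain Y where Y: "skew_mat n Y" "Y *\<^sub>v v \<noteq> 0\<^sub>v n" using skew_not_annihilating[OF v v0 n] .
    have Yc: "Y \<in> carrier_mat n n" using Y unfolding skew_mat_def by blast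
    have "(J + \<delta> \<cdot>\<^sub>m Y) *\<^sub>v v \<noteq> 0\<^sub>v n" if "0 < \<delta>" for \<delta>
    proof
      assume "(J + \<delta> \<cdot>\<^sub>m Y) *\<^sub>v v = 0\<^sub>v n"
      moreover have "(J + \<delta> \<cdot>\<^sub>m Y) *\<^sub>v v = 0\<^sub>v n + \<delta> \<cdot>\<^sub>v (Y *\<^sub>v v)"
        using add_mult_distrib_mat_vec[OF carr(3), of "\<delta> \<cdot>\<^sub>m Y" v] smult_mat_mult_vec[OF Yc v] True v Yc by simp
      ultimately have zero: "\<delta> \<cdot>\<^sub>v (Y *\<^sub>v v) = 0\<^sub>v n" using Yc v by simp
      have "Y *\<^sub>v v = 0\<^sub>v n"
      proof (rule eq_vecI)
        fix i assume "i < dim_vec (0\<^sub>v n :: real vec)"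
        then show "(Y *\<^sub>v v) $ i = 0\<^sub>v n $ i"
          using arg_cong[OF zero, of "\<lambda>z. z $ i"] Yc that by (simp del: index_mult_mat_vec)
      qed (use Yc in simp)
      with Y show False by blast
    qed
    with Y show thesis using that by blast
  next
    case False
    have "J + \<delta> \<cdot>\<^sub>m 0\<^sub>m n n = J" for \<delta> by (intro eq_matI) (use carr in auto)
    moreover have "skew_mat n (0\<^sub>m n n)" unfolding skew_mat_def by auto
    ultimately show thesis using that[of "0\<^sub>m n n"] False by simp
  qed
  have Yc: "Y \<in> carrier_mat n n" using Y unfolding skew_mat_def by blast
  show ?thesis unfolding in_closure_of_index_two_def
  proof (intro allI impI)
    fix \<epsilon> :: real assume \<epsilon>: "0 < \<epsilon>"
    define F where "F = frobenius_norm (append_cols X Y)"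
    have F: "0 \<le> F" unfolding F_def frobenius_norm_def by (intro real_sqrt_ge_zero sum_nonneg) simp
    define \<delta> where "\<delta> = \<epsilon> / (F + 1)"
    have \<delta>: "0 < \<delta>" "\<delta> * F \<le> \<epsilon>" using \<epsilon> F by (simp_all add: \<delta>_def field_simps)
    define E' where "E' = E + \<delta> \<cdot>\<^sub>m X"
    define J' where "J' = J + \<delta> \<cdot>\<^sub>m Y"
    have E'c: "E' \<in> carrier_mat n n" and J'c: "J' \<in> carrier_mat n n" using Xc Yc by (simp_all add: E'_def J'_def)
    have E'x: "E' *\<^sub>v x = E *\<^sub>v x + \<delta> \<cdot>\<^sub>v (X *\<^sub>v x)" if "x \<in> carrier_vec n" for x
      using add_mult_distrib_mat_vec[OF carr(1), of "\<delta> \<cdot>\<^sub>m X" x] smult_mat_mult_vec[OF Xc that] Xc that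
      by (simp add: E'_def)
    have quad: "x \<bullet> (E' *\<^sub>v x) = x \<bullet> (E *\<^sub>v x) + \<delta> * (x \<bullet> (X *\<^sub>v x))" if "x \<in> carrier_vec n" for x
      unfolding E'x[OF that] using that carr Xc by (simp add: scalar_prod_add_distrib[of _ n])
    have nonneg: "0 \<le> x \<bullet> (E *\<^sub>v x)" "0 \<le> \<delta> * (x \<bullet> (X *\<^sub>v x))" if "x \<in> carrier_vec n" for x
      using E X that \<delta> unfolding psd_mat_def by auto
    have transpose_smult: "transpose_mat (\<delta> \<cdot>\<^sub>m A) = \<delta> \<cdot>\<^sub>m transpose_mat A" for A by (intro eq_matI) auto
    have "transpose_mat E' = E'"
      using E X transpose_add[OF carr(1), of "\<delta> \<cdot>\<^sub>m X"] Xc unfolding psd_mat_def E'_def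
      by (simp add: transpose_smult)
    then have psdE': "psd_mat n E'" using E'c quad nonneg unfolding psd_mat_def by simp
    have T: "transpose_mat J = - J" "transpose_mat Y = - Y"
      using J Y unfolding skew_mat_def by (metis uminus_uminus_mat)+
    have "transpose_mat J' = - J'"
      using T transpose_add[OF carr(3), of "\<delta> \<cdot>\<^sub>m Y"] Yc carr unfolding J'_def
      by (simp add: transpose_smult, intro eq_matI) auto
    then have skewJ': "skew_mat n J'" using J'c unfolding skew_mat_def by simp
    have triple: "dissipative_triple n E' J' R" using psdE' skewJ' R unfolding dissipative_triple_def by blast
    have kernel: "E' *\<^sub>v x = 0\<^sub>v n \<longleftrightarrow> (\<exists>a. x = a \<cdot>\<^sub>v v)" if x: "x \<in> carrier_vec n" for x
    proof
      assume "E' *\<^sub>v x = 0\<^sub>v n"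
      then have "x \<bullet> (E *\<^sub>v x) + \<delta> * (x \<bullet> (X *\<^sub>v x)) = 0" using quad[OF x] x by simp
      then have "\<delta> * (x \<bullet> (X *\<^sub>v x)) = 0" using nonneg[OF x] by linarith
      then have "X *\<^sub>v x = 0\<^sub>v n" using psd_scalar_prod_eq_0[OF X(1) x] \<delta> by simp
      then show "\<exists>a. x = a \<cdot>\<^sub>v v" using X(2)[OF x] by blast
    next
      assume ex: "\<exists>a. x = a \<cdot>\<^sub>v v"
      then have Xx: "X *\<^sub>v x = 0\<^sub>v n" using X(2)[OF x] by blast
      from ex obtain a where a: "x = a \<cdot>\<^sub>v v" by blast
      have "E *\<^sub>v x = a \<cdot>\<^sub>v 0\<^sub>v n" unfolding a mult_mat_vec[OF carr(1) v] Ev ..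
      then show "E' *\<^sub>v x = 0\<^sub>v n" unfolding E'x[OF x] Xx by (simp, intro eq_vecI) auto
    qed
    have J'v: "J' *\<^sub>v v \<noteq> 0\<^sub>v n" unfolding J'_def by (rule Y(2)[OF \<delta>(1)])
    have EE': "E - E' = (- \<delta>) \<cdot>\<^sub>m X" unfolding E'_def by (intro eq_matI) (use carr Xc in auto)
    have JJ': "J - J' = (- \<delta>) \<cdot>\<^sub>m Y" "(J - R) - (J' - R) = (- \<delta>) \<cdot>\<^sub>m Y"
      unfolding J'_def by (intro eq_matI; use carr Yc in auto)+
    have RR: "R - R = 0\<^sub>m n n" using carr by simp
    have smult_carr: "(- \<delta>) \<cdot>\<^sub>m X \<in> carrier_mat n n" "(- \<delta>) \<cdot>\<^sub>m Y \<in> carrier_mat n n" using Xc Yc by simp_all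
    have app: "append_cols ((- \<delta>) \<cdot>\<^sub>m X) ((- \<delta>) \<cdot>\<^sub>m Y) \<in> carrier_mat n (n + n)"
      using Xc Yc by (intro carrier_matI) (simp_all add: append_cols_dim)
    have eq: "frobenius_norm (append_cols (E - E') (append_cols (J - J') (R - R))) =
        frobenius_norm (append_cols (E - E') ((J - R) - (J' - R)))"
      unfolding EE' JJ' RR append_cols_append_zero[OF smult_carr] by (rule frobenius_norm_append_zero[OF app])
    have "frobenius_norm (append_cols (E - E') ((J - R) - (J' - R))) = \<delta> * F"
      unfolding EE' JJ' append_cols_smult[OF Xc Yc] frobenius_norm_smult F_def using \<delta> by simp
    then show "\<exists>E' J' R'. psd_mat n E' \<and> psd_mat n R' \<and> skew_mat n J' \<and>
        regular_pencil (complexify E') (complexify (J' - R')) \<and>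
        pencil_index (complexify E') (complexify (J' - R')) = 2 \<and>
        frobenius_norm (append_cols (E - E') (append_cols (J - J') (R - R'))) =
          frobenius_norm (append_cols (E - E') ((J - R) - (J' - R'))) \<and>
        frobenius_norm (append_cols (E - E') ((J - R) - (J' - R'))) \<le> \<epsilon>"
      using psdE' R skewJ' index_two_perturbation[OF triple v kernel Rv J'v] eq \<delta>(2) by metis
  qed
qed

section \<open>The structure theorem\<close>

theorem theorem5:
  fixes n :: nat and E J R :: "real mat"
  assumes "psd_mat n E" and "psd_mat n R" and "skew_mat n J"
  shows
    "(singular_pencil (complexify E) (complexify (J - R)) \<longleftrightarrow>
        mat_kernel J \<inter> mat_kernel E \<inter> mat_kernel R \<noteq> {0\<^sub>v n}) \<and>
     (singular_pencil (complexify E) (complexify (J - R)) \<longrightarrow>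
        (let r = kernel_dim (E - J + R) in
           0 < r \<and>
           (\<exists>U E\<^sub>1\<^sub>1 J\<^sub>1\<^sub>1 R\<^sub>1\<^sub>1.
              real_orthogonal_mat n U \<and>
              E\<^sub>1\<^sub>1 \<in> carrier_mat (n - r) (n - r) \<and>
              J\<^sub>1\<^sub>1 \<in> carrier_mat (n - r) (n - r) \<and>
              R\<^sub>1\<^sub>1 \<in> carrier_mat (n - r) (n - r) \<and>
              transpose_mat U * E * U = four_block_mat E\<^sub>1\<^sub>1 (0\<^sub>m (n - r) r) (0\<^sub>m r (n - r)) (0\<^sub>m r r) \<and>
              transpose_mat U * J * U = four_block_mat J\<^sub>1\<^sub>1 (0\<^sub>m (n - r) r) (0\<^sub>m r (n - r)) (0\<^sub>m r r) \<and>
              transpose_mat U * R * U = four_block_mat R\<^sub>1\<^sub>1 (0\<^sub>m (n - r) r) (0\<^sub>m r (n - r)) (0\<^sub>m r r) \<and>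
              regular_pencil (complexify E\<^sub>1\<^sub>1) (complexify (J\<^sub>1\<^sub>1 - R\<^sub>1\<^sub>1)))) \<and>
        (\<exists>K. kronecker_form (complexify E) (complexify (J - R)) K) \<and>
        (\<forall>K. kronecker_form (complexify E) (complexify (J - R)) K \<longrightarrow>
           (\<forall>\<epsilon>\<in>right_minimal_indices K. \<epsilon> = 0) \<and> (\<forall>\<eta>\<in>left_minimal_indices K. \<eta> = 0))) \<and>
     pencil_index (complexify E) (complexify (J - R)) \<le> 2 \<and>
     (in_closure_of_index_two n E J R \<longrightarrow> mat_kernel E \<inter> mat_kernel R \<noteq> {0\<^sub>v n}) \<and>
     (n \<noteq> 1 \<longrightarrow>
        (in_closure_of_index_two n E J R \<longleftrightarrow> mat_kernel E \<inter> mat_kernel R \<noteq> {0\<^sub>v n}))"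
proof -
  let ?E = "complexify E" and ?A = "complexify (J - R)"
  have triple: "dissipative_triple n E J R" using assms unfolding dissipative_triple_def by blast
  note carr = dissipative_carriers[OF triple]
  have singular_iff: "singular_pencil ?E ?A \<longleftrightarrow> mat_kernel J \<inter> mat_kernel E \<inter> mat_kernel R \<noteq> {0\<^sub>v n}"
    unfolding singular_pencil_def dissipative_regular_iff[OF triple] dissipative_common_kernel_iff[OF triple] by simp
  have minimal: "\<forall>K. kronecker_form ?E ?A K \<longrightarrow>
      (\<forall>\<epsilon>\<in>right_minimal_indices K. \<epsilon> = 0) \<and> (\<forall>\<eta>\<in>left_minimal_indices K. \<eta> = 0)"
    using right_minimal_indices_zero[OF _ _ _ dissipative_no_long_complex_chain(1)[OF triple], of _ n n]
      left_minimal_indices_zero[OF _ _ _ dissipative_no_long_complex_chain(2)[OF triple], of _ n n]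
      map_carrier_mat carr(1,4) by blast
  obtain m r U E1 J1 R1 where n: "n = m + r" and U: "real_orthogonal_mat n U"
    and triple1: "dissipative_triple m E1 J1 R1" and det1: "det (E1 - J1 + R1) \<noteq> 0"
    and eqs: "transpose_mat U * E * U = direct_sum_mat E1 (0\<^sub>m r r)"
      "transpose_mat U * J * U = direct_sum_mat J1 (0\<^sub>m r r)" "transpose_mat U * R * U = direct_sum_mat R1 (0\<^sub>m r r)"
    using dissipative_deflation[OF triple] by blast
  note carr1 = dissipative_carriers[OF triple1]
  have Uc: "U \<in> carrier_mat n n" using U unfolding real_orthogonal_mat_def by blast
  have EJ: "E - J \<in> carrier_mat n n" using carr(2) by (rule minus_carrier_mat)
  have deflated: "transpose_mat U * (E - J + R) * U = direct_sum_mat (E1 - J1 + R1) (0\<^sub>m r r)"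
    unfolding congruence_add(1)[OF EJ carr(3) Uc] congruence_add(2)[OF carr(1,2) Uc] eqs
    by (intro eq_matI) (use carr1 in auto)
  have r: "kernel_dim (E - J + R) = r"
    using kernel_dim_deflated[OF _ _ carr1(5) det1] carr(5) U deflated unfolding n by blast
  have r_pos: "0 < r" if "singular_pencil ?E ?A"
  proof (rule ccontr)
    assume "\<not> 0 < r"
    \<comment> \<open>Then \<open>E - J + R\<close> would be congruent to an invertible matrix.\<close>
    then have r0: "r = 0" by simp
    have "transpose_mat U * (E - J + R) * U = E1 - J1 + R1"
      unfolding deflated r0
      by (intro eq_matI) (use carr1 in auto)
    moreover have "det (transpose_mat U * (E - J + R) * U) = det (transpose_mat U) * det (E - J + R) * det U"
      using det_mult[of "transpose_mat U * (E - J + R)" n U] det_mult[of "transpose_mat U" n "E - J + R"] Uc carr(5) by simp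
    ultimately have "det (E - J + R) \<noteq> 0" using det1 by auto
    with that show False unfolding singular_pencil_def dissipative_regular_iff[OF triple] by simp
  qed
  have nr: "n - r = m" using n by simp
  have blocks: "direct_sum_mat X (0\<^sub>m r r) = four_block_mat X (0\<^sub>m (n - r) r) (0\<^sub>m r (n - r)) (0\<^sub>m r r)"
    if "X \<in> carrier_mat m m" for X :: "real mat"
    using that unfolding nr by simp
  have deflation: "\<exists>U E\<^sub>1\<^sub>1 J\<^sub>1\<^sub>1 R\<^sub>1\<^sub>1.
      real_orthogonal_mat n U \<and>
      E\<^sub>1\<^sub>1 \<in> carrier_mat (n - r) (n - r) \<and>
      J\<^sub>1\<^sub>1 \<in> carrier_mat (n - r) (n - r) \<and>
      R\<^sub>1\<^sub>1 \<in> carrier_mat (n - r) (n - r) \<and>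
      transpose_mat U * E * U = four_block_mat E\<^sub>1\<^sub>1 (0\<^sub>m (n - r) r) (0\<^sub>m r (n - r)) (0\<^sub>m r r) \<and>
      transpose_mat U * J * U = four_block_mat J\<^sub>1\<^sub>1 (0\<^sub>m (n - r) r) (0\<^sub>m r (n - r)) (0\<^sub>m r r) \<and>
      transpose_mat U * R * U = four_block_mat R\<^sub>1\<^sub>1 (0\<^sub>m (n - r) r) (0\<^sub>m r (n - r)) (0\<^sub>m r r) \<and>
      regular_pencil (complexify E\<^sub>1\<^sub>1) (complexify (J\<^sub>1\<^sub>1 - R\<^sub>1\<^sub>1))"
  proof (rule exI[of _ U], rule exI[of _ E1], rule exI[of _ J1], rule exI[of _ R1], intro conjI)
    show "regular_pencil (complexify E1) (complexify (J1 - R1))"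
      using dissipative_regular_iff[OF triple1] det1 by blast
  qed (use U carr1 nr eqs blocks[OF carr1(1)] blocks[OF carr1(2)] blocks[OF carr1(3)] in \<open>simp_all only:\<close>)
  show ?thesis
    unfolding Let_def r
    using singular_iff r_pos deflation dissipative_kronecker_form_exists[OF triple] minimal
      dissipative_pencil_index_le_2[OF triple] common_kernel_if_in_closure[OF assms]
      in_closure_if_common_kernel[OF assms] by blast
qed

end
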